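(* Let $d$ be a positive integer, fix $s\in[0,\infty)$, and let $f\colon\mathbb{R}^d\to[0,\infty)$ be an upper semi-continuous log-concave function of finite positive integral. Then there exists a unique solution to the problem $$\min_{\ell\in\mathcal{E}^d[\psi_s]}\int_{\mathbb{R}^d}\ell\quad\text{subject to}\quad f\le\ell.$$
   Context: $|\cdot|$ denotes the Euclidean norm. A function $f\colon\mathbb{R}^d\to[0,\infty)$ is log-concave if $f=e^{-\varphi}$ for a convex function $\varphi\colon\mathbb{R}^d\to\mathbb{R}\cup\{+\infty\}$ (with $e^{-\infty}=0$). The relation $f_1\le f_2$ means $f_1(x)\le f_2(x)$ for all $x\in\mathbb{R}^d$. The function $\psi_s\colon[0,\infty)\to[0,\infty)$ is defined by $\psi_0(t)=t$ and, for $s\in(0,\infty)$, $$\psi_s(t)=\frac{s}{2}\left[\sqrt{1+4\left(\tfrac{t}{s}\right)^2}-\ln\left(\frac{1+\sqrt{1+4(t/s)^2}}{2}\right)-1\right].$$ $\mathcal{E}^d[\psi_s]$ is the class of functions on $\mathbb{R}^d$ of the form $x\mapsto\alpha e^{-\psi_s(|A(x-a)|)}$ with $A\in\mathrm{GL}(d)$, $\alpha>0$, $a\in\mathbb{R}^d$. Uniqueness of the solution means uniqueness as a function. *)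

theory Defs
  imports "HOL-Analysis.Analysis"
begin

(* Convexity for functions into the reals with +infinity adjoined. The weights are strictly
   positive, so no product 0 * infinity occurs; the cases u = 0 and v = 0 are trivial. *)
definition convex_ext :: "('a::real_vector \<Rightarrow> ereal) \<Rightarrow> bool" where
  "convex_ext \<phi> \<longleftrightarrow> (\<forall>x. \<phi> x \<noteq> -\<infinity>) \<and>
    (\<forall>x y. \<forall>u>0. \<forall>v>0. u + v = 1 \<longrightarrow>
      \<phi> (u *\<^sub>R x + v *\<^sub>R y) \<le> ereal u * \<phi> x + ereal v * \<phi> y)"

definition log_concave_fun :: "('a::real_vector \<Rightarrow> real) \<Rightarrow> bool" where
  "log_concave_fun f \<longleftrightarrow> (\<exists>\<phi>. convex_ext \<phi> \<and>
    (\<forall>x. f x = (if \<phi> x = \<infinity> then 0 else exp (- real_of_ereal (\<phi> x)))))"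

definition upper_semicontinuous :: "('a::topological_space \<Rightarrow> real) \<Rightarrow> bool" where
  "upper_semicontinuous f \<longleftrightarrow> (\<forall>x. \<forall>c>f x. \<forall>\<^sub>F y in nhds x. f y < c)"

(* Meaningful for s \<ge> 0 and t \<ge> 0. *)
definition psi :: "real \<Rightarrow> real \<Rightarrow> real" where
  "psi s t = (if s = 0 then t else
    s / 2 * (sqrt (1 + 4 * (t / s)\<^sup>2) - ln ((1 + sqrt (1 + 4 * (t / s)\<^sup>2)) / 2) - 1))"

definition ellipsoidal_class :: "(real \<Rightarrow> real) \<Rightarrow> ((real ^ 'n::finite) \<Rightarrow> real) set" where
  "ellipsoidal_class \<psi> =
    {(\<lambda>x. \<alpha> * exp (- \<psi> (norm (A *v (x - a))))) | (A :: real ^ 'n ^ 'n) \<alpha> a.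
       invertible A \<and> \<alpha> > 0}"

end

theory Submission
  imports Defs
begin

text \<open>Write the members of the class as \<open>exp (\<beta> - h |A x - b|)\<close>; the integral is a constant multiple of
  \<open>exp \<beta> / |det A|\<close>, and the set of \<open>(A, b, \<beta>)\<close> lying above \<open>f\<close> is convex because \<open>h\<close> is convex and
  nondecreasing. For existence, \<open>f\<close> is at least some \<open>e > 0\<close> on a ball and decays exponentially, which
  makes the triples above \<open>f\<close> whose cost is at most a given constant a nonempty compact set.
  For uniqueness, the midpoint of two minimizers, one of them rotated so that their quotient is
  positive definite, is strictly cheaper unless the two matrices agree. If then only the centers
  differ, the parallelogram law gains enough in the exponent to pay for shrinking \<open>A\<close>; this covers the
  case \<open>s = 0\<close> as well, where \<open>h\<close> is not strictly convex.\<close>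

subsection \<open>Polar decomposition\<close>

text \<open>A function of the class determines its matrix only up to a left orthogonal factor, and
  averaging two arbitrary representatives can fail badly: for B = -A the midpoint is singular. The
  polar decomposition of B A^-1 picks the factor U for which U B = P A with P positive definite; the
  midpoint is then (1 + P) A / 2, and its determinant can be compared with those of A and B
  eigenvalue by eigenvalue. The same decomposition reduces the volume formula to rotations and
  diagonal matrices. The centers are a separate obstacle: the cost does not see them, so once the
  matrices agree, averaging alone yields a cover of equal cost and no contradiction. For
  compactness, covering a ball bounds the entries of A only linearly in \<beta>, and \<beta> itself
  may be large. The cost bound ties exp \<beta> to |det A|, which is at most polynomial in \<beta>,
  and the exponential wins.\<close>

lemma self_adjoint_eigenvector:
  fixes f :: "'a::euclidean_space \<Rightarrow> 'a"
  assumes f: "linear f" and sa: "\<And>x y. f x \<bullet> y = x \<bullet> f y"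
    and T: "subspace T" "f ` T \<subseteq> T" "T \<noteq> {0}"
  obtains v c where "v \<in> T" "norm v = 1" "f v = c *\<^sub>R v"
proof -
  interpret linear f by (rule f)
  obtain w where w: "w \<in> T" "w \<noteq> 0" using T subspace_0 by blast
  let ?S = "T \<inter> sphere 0 1"
  have "w /\<^sub>R norm w \<in> ?S" using w T(1) by (simp add: subspace_scale)
  hence ne: "?S \<noteq> {}" by blast
  have cp: "compact ?S" using T(1) by (simp add: closed_subspace closed_Int_compact)
  have ct: "continuous_on ?S (\<lambda>x. f x \<bullet> x)"
    by (intro continuous_intros linear_continuous_on) (simp add: f linear_conv_bounded_linear[symmetric])
  obtain v where v: "v \<in> ?S" and mx: "\<And>x. x \<in> ?S \<Longrightarrow> f x \<bullet> x \<le> f v \<bullet> v"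
    using continuous_attains_sup[OF cp ne ct] by blast
  define c where "c = f v \<bullet> v"
  \<comment> \<open>By maximality of \<open>c\<close> the quadratic form \<open>q\<close> is
    nonnegative on \<open>T\<close>, and it vanishes at \<open>v\<close>. Perturbing
    \<open>v\<close> along the residual \<open>r\<close> would make it negative to first order
    unless \<open>r\<close> is zero.\<close>
  define q where "q x = c * (x \<bullet> x) - f x \<bullet> x" for x
  have vv: "v \<bullet> v = 1" using v by (simp add: dot_square_norm)
  have q0: "q x \<ge> 0" if "x \<in> T" for x
  proof (cases "x = 0")
    case False
    have "x /\<^sub>R norm x \<in> ?S" using that False T(1) by (simp add: subspace_scale)
    from mx[OF this] have "(f x \<bullet> x) / (norm x)^2 \<le> c"
      by (simp add: c_def scale power2_eq_square field_simps)
    thus ?thesis using False by (simp add: q_def dot_square_norm field_simps)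
  qed (simp add: q_def)
  define r where "r = c *\<^sub>R v - f v"
  have rT: "r \<in> T" using v T by (auto simp: r_def subspace_diff subspace_scale)
  have ex: "q (v + t *\<^sub>R r) = 2 * t * (r \<bullet> r) + t^2 * q r" for t
  proof -
    have "f r \<bullet> v = r \<bullet> f v" by (rule sa)
    moreover have "f v \<bullet> r = r \<bullet> f v" by (rule inner_commute)
    moreover have "q (v + t *\<^sub>R r) = c * (v \<bullet> v) - f v \<bullet> v + t * (2 * c * (r \<bullet> v) - f r \<bullet> v - f v \<bullet> r) + t^2 * q r"
      unfolding q_def by (simp add: add scale inner_add_left inner_add_right inner_commute power2_eq_square algebra_simps)
    moreover have "r \<bullet> r = c * (r \<bullet> v) - r \<bullet> f v"
      by (subst (2) r_def) (simp add: inner_diff_right)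
    ultimately have "q (v + t *\<^sub>R r) = t * (2 * (r \<bullet> r)) + t^2 * q r" using vv
      by (simp add: c_def)
    thus ?thesis by simp
  qed
  have "r \<bullet> r = 0"
  proof (rule ccontr)
    assume "r \<bullet> r \<noteq> 0"
    hence rp: "r \<bullet> r > 0" by simp
    have qr: "q r \<ge> 0" using q0 rT by blast
    \<comment> \<open>Minimizing the quadratic in \<open>t\<close> suggests dividing by
      \<open>q r\<close>; the \<open>+ 1\<close> covers the case that \<open>q r\<close> is
      zero.\<close>
    define t where "t = - (r \<bullet> r) / (q r + 1)"
    have "q (v + t *\<^sub>R r) \<ge> 0" using q0 v rT T(1) by (simp add: subspace_add subspace_scale)
    moreover have "2 * t * (r \<bullet> r) + t^2 * q r = - ((r \<bullet> r)^2 / (q r + 1)) * (2 - q r / (q r + 1))"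
      using qr unfolding t_def by (simp add: divide_simps power2_eq_square) (simp add: algebra_simps)
    moreover have "(r \<bullet> r)^2 / (q r + 1) > 0" using rp qr by simp
    moreover have "q r / (q r + 1) < 2" using qr by (simp add: field_simps)
    ultimately show False using ex by (smt (verit) mult_neg_pos divide_minus_left)
  qed
  hence "f v = c *\<^sub>R v" by (simp add: r_def)
  thus ?thesis using that v by auto
qed

text \<open>Induction on the dimension: self-adjointness keeps the orthogonal complement of an
  eigenvector in \<open>T\<close> invariant.\<close>

lemma self_adjoint_orthonormal_basis:
  fixes f :: "'a::euclidean_space \<Rightarrow> 'a"
  assumes f: "linear f" and sa: "\<And>x y. f x \<bullet> y = x \<bullet> f y"
    and "subspace T" "f ` T \<subseteq> T"
  shows "\<exists>B. B \<subseteq> T \<and> pairwise orthogonal B \<and> finite B \<and> card B = dim T \<and>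
    (\<forall>v\<in>B. norm v = 1 \<and> (\<exists>c. f v = c *\<^sub>R v))"
  using assms(3,4)
proof (induction "dim T" arbitrary: T)
  case 0
  thus ?case by (intro exI[of _ "{}"]) auto
next
  case (Suc n)
  have "T \<noteq> {0}" using Suc.hyps(2) by auto
  then obtain v c where v: "v \<in> T" "norm v = 1" "f v = c *\<^sub>R v"
    using self_adjoint_eigenvector[OF f sa Suc.prems] by blast
  let ?T = "{y \<in> T. \<forall>x\<in>span {v}. orthogonal x y}"
  have eqT: "?T = {y \<in> T. v \<bullet> y = 0}"
    by (auto simp: orthogonal_def span_singleton)
  have "dim ?T + dim (span {v}) = dim T"
    using Suc.prems v span_minimal[of "{v}" T] by (intro dim_subspace_orthogonal_to_vectors) auto
  moreover have "dim (span {v}) = 1" using v by (subst dim_span, subst dim_singleton) auto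
  ultimately have dimT: "n = dim ?T" using Suc.hyps(2) by simp
  have sub: "subspace ?T" using Suc.prems unfolding eqT subspace_def by (auto simp: inner_add_right)
  have inv: "f ` ?T \<subseteq> ?T" unfolding eqT using Suc.prems(2) by (auto simp: sa[symmetric] v)
  obtain B where B: "B \<subseteq> ?T" "pairwise orthogonal B" "finite B" "card B = dim ?T"
    "\<forall>v\<in>B. norm v = 1 \<and> (\<exists>c. f v = c *\<^sub>R v)"
    using Suc.hyps(1)[OF dimT sub inv] by blast
  have Bv: "\<forall>x\<in>B. v \<bullet> x = 0" using B(1) eqT by blast
  hence "v \<notin> B" using v(2) by (metis inner_eq_zero_iff norm_zero zero_neq_one)
  show ?case
  proof (intro exI[of _ "insert v B"] conjI)
    show "insert v B \<subseteq> T" using B v by auto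
    show "pairwise orthogonal (insert v B)" using B(2) Bv
      by (auto simp: pairwise_insert orthogonal_def inner_commute)
    show "card (insert v B) = dim T" using B \<open>v \<notin> B\<close> dimT Suc.hyps(2) by simp
  qed (use B v in auto)
qed

lemma symmetric_matrix_diagonalizable:
  fixes S :: "real^'n^'n"
  assumes "transpose S = S"
  obtains Q c where "orthogonal_matrix Q" "S = transpose Q ** (\<chi> i j. if i = j then c i else 0) ** Q"
proof -
  have sa: "(S *v x) \<bullet> y = x \<bullet> (S *v y)" for x y
    by (metis assms dot_lmul_matrix transpose_matrix_vector)
  have lin: "linear ((*v) S)" by simp
  obtain B :: "(real^'n) set" where B: "pairwise orthogonal B" "finite B" "card B = CARD('n)"
    and Bv: "\<forall>v\<in>B. norm v = 1 \<and> (\<exists>c. S *v v = c *\<^sub>R v)"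
    using self_adjoint_orthonormal_basis[OF lin sa subspace_UNIV] by auto
  obtain g where g: "bij_betw g (UNIV::'n set) B"
    using B by (metis finite_same_card_bij finite)
  have gB: "g i \<in> B" for i using g by (auto simp: bij_betw_def)
  have g1: "norm (g i) = 1" for i using gB Bv by blast
  from gB Bv have "\<forall>i. \<exists>c. S *v g i = c *\<^sub>R g i" by blast
  then obtain c where c: "\<And>i. S *v g i = c i *\<^sub>R g i" by metis
  have orth: "orthogonal (g i) (g j)" if "i \<noteq> j" for i j
    using pairwiseD[OF B(1) gB gB] g that by (auto simp: bij_betw_def inj_on_def)
  define Q :: "real^'n^'n" where "Q = (\<chi> i. g i)"
  have rowQ: "row i Q = g i" for i by (simp add: Q_def row_def vec_eq_iff)
  have oQ: "orthogonal_matrix Q"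
    by (simp add: orthogonal_matrix_orthonormal_rows rowQ g1 orth)
  let ?D = "(\<chi> i j. if i = j then c i else 0) :: real^'n^'n"
  have "S ** transpose Q = transpose Q ** ?D"
  proof -
    have "(S ** transpose Q) $ i $ j = (transpose Q ** ?D) $ i $ j" for i j
    proof -
      have "(S ** transpose Q) $ i $ j = (S *v g j) $ i"
        by (simp add: matrix_matrix_mult_def matrix_vector_mult_def transpose_def Q_def)
      also have "\<dots> = (transpose Q ** ?D) $ i $ j"
        by (simp add: c matrix_matrix_mult_def transpose_def Q_def if_distrib mult.commute cong: if_cong)
      finally show ?thesis .
    qed
    thus ?thesis by (simp add: vec_eq_iff)
  qed
  hence "S ** transpose Q ** Q = transpose Q ** ?D ** Q" by simp
  hence "S = transpose Q ** ?D ** Q"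
    using oQ by (simp add: matrix_mul_assoc[symmetric] orthogonal_matrix_def)
  with oQ show ?thesis by (rule that)
qed

lemma norm_orthogonal_matrix:
  fixes Q :: "real^'n^'n"
  assumes "orthogonal_matrix Q"
  shows "norm (Q *v x) = norm x"
  using assms orthogonal_transformation_matrix[of "(*v) Q"] by (simp add: orthogonal_transformation)

lemma inner_transpose_matrix:
  fixes M :: "real^'n^'m"
  shows "x \<bullet> (transpose M *v y) = (M *v x) \<bullet> y"
  by (metis dot_lmul_matrix inner_commute transpose_matrix_vector transpose_transpose)

text \<open>\<open>U\<close> is P M^-1 with P the positive square root of
  \<open>transpose M ** M\<close>, and it is orthogonal because P and M have the same Gram matrix. P
  stays in diagonalized form since determinants and integrals are read off from the numbers
  \<open>c i\<close>.\<close>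

lemma invertible_matrix_polar:
  fixes M :: "real^'n^'n"
  assumes "invertible M"
  obtains U Q c where "orthogonal_matrix U" "orthogonal_matrix Q" "\<And>i. c i > 0"
    "U ** M = transpose Q ** (\<chi> i j. if i = j then c i else 0) ** Q"
proof -
  obtain N where inv: "M ** N = mat 1" "N ** M = mat 1"
    using assms by (auto simp: invertible_def)
  have "transpose (transpose M ** M) = transpose M ** M" by (simp add: matrix_transpose_mul)
  then obtain Q c where Q: "orthogonal_matrix Q"
    and S: "transpose M ** M = transpose Q ** (\<chi> i j. if i = j then c i else 0) ** Q"
    by (rule symmetric_matrix_diagonalizable)
  let ?D = "(\<chi> i j. if i = j then c i else 0) :: real^'n^'n"
  let ?R = "(\<chi> i j. if i = j then sqrt (c i) else 0) :: real^'n^'n"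
  have QQ: "transpose Q ** Q = mat 1" "Q ** transpose Q = mat 1" using Q by (auto simp: orthogonal_matrix_def)
  have D: "?D = Q ** (transpose M ** M) ** transpose Q"
    unfolding S by (simp add: matrix_mul_assoc QQ) (simp add: matrix_mul_assoc[symmetric] QQ)
  \<comment> \<open>The eigenvalue \<open>c i\<close> is the squared length of \<open>M\<close>
    applied to the eigenvector \<open>transpose Q *v axis i 1\<close>.\<close>
  have c: "c i > 0" for i
  proof -
    have "c i = axis i 1 \<bullet> (?D *v axis i 1)"
      by (simp add: inner_axis' matrix_vector_mult_basis column_def)
    also have "?D *v axis i 1 = Q *v (transpose M *v (M *v (transpose Q *v axis i 1)))"
      unfolding D by (simp only: matrix_vector_mul_assoc matrix_mul_assoc)
    also have "axis i 1 \<bullet> \<dots> = (M *v (transpose Q *v axis i 1)) \<bullet> (M *v (transpose Q *v axis i 1))"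
      using inner_transpose_matrix[of "axis i 1" "transpose Q"]
      by (simp only: inner_transpose_matrix transpose_transpose)
    also have "\<dots> > 0"
    proof -
      have "norm (transpose Q *v axis i 1) = 1" using Q norm_orthogonal_matrix[of "transpose Q"] by simp
      hence "transpose Q *v axis i 1 \<noteq> 0" by auto
      hence "M *v (transpose Q *v axis i 1) \<noteq> 0"
        using inv by (metis matrix_vector_mul_assoc matrix_vector_mul_lid matrix_vector_mult_0_right)
      thus ?thesis by simp
    qed
    finally show ?thesis .
  qed
  have "(?R ** ?R) $ i $ j = ?D $ i $ j" for i j
  proof -
    have "(?R ** ?R) $ i $ j = (\<Sum>k\<in>UNIV. if k = i then (if i = j then c i else 0) else 0)"
      using c unfolding matrix_matrix_mult_def vec_lambda_beta
      by (intro sum.cong) (auto simp: less_imp_le)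
    thus ?thesis by simp
  qed
  hence R: "?R ** ?R = ?D" "transpose ?R = ?R"
    by (auto simp: vec_eq_iff transpose_def)
  let ?P = "transpose Q ** ?R ** Q"
  have PP: "transpose ?P ** ?P = transpose M ** M"
  proof -
    have "transpose ?P ** ?P = transpose Q ** ?R ** (Q ** transpose Q) ** ?R ** Q"
      by (simp only: matrix_transpose_mul transpose_transpose R(2) matrix_mul_assoc)
    also have "\<dots> = transpose M ** M"
      unfolding S R(1)[symmetric] QQ by (simp only: matrix_mul_rid matrix_mul_assoc)
    finally show ?thesis .
  qed
  define U where "U = ?P ** N"
  have UM: "U ** M = ?P" using inv by (simp only: U_def matrix_mul_assoc[symmetric] matrix_mul_rid)
  have "transpose U ** U = transpose (N) ** (transpose ?P ** ?P) ** N"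
    by (simp only: U_def matrix_transpose_mul matrix_mul_assoc)
  also have "\<dots> = transpose (M ** N) ** (M ** N)"
    unfolding PP by (simp only: matrix_transpose_mul matrix_mul_assoc)
  also have "\<dots> = mat 1" using inv by simp
  finally have "orthogonal_matrix U" by (simp add: orthogonal_matrix)
  thus ?thesis using that[of U Q "\<lambda>i. sqrt (c i)"] Q c UM by simp
qed

subsection \<open>Convex profiles\<close>

text \<open>The properties of the profile on which existence and uniqueness rest. Strict convexity
  is left out so that the identity, the case s = 0, qualifies. Positivity and convexity force linear
  growth; \<open>le_id\<close> lets an exponentially decaying function be covered.\<close>

locale convex_profile =
  fixes h :: "real \<Rightarrow> real"
  assumes zero: "h 0 = 0"
    and convex: "convex_on {0..} h"
    and continuous: "continuous_on {0..} h"
    and pos: "t > 0 \<Longrightarrow> h t > 0"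
    and le_id: "t \<ge> 0 \<Longrightarrow> h t \<le> t"
begin

lemma nonneg: "t \<ge> 0 \<Longrightarrow> h t \<ge> 0"
  using pos[of t] zero by (cases "t = 0") auto

text \<open>Convexity between 0 and \<open>b\<close> together with \<open>h 0 = 0\<close>; in other
  words \<open>h t / t\<close> is nondecreasing. The remaining inequalities of this context draw on
  convexity only in this form.\<close>

lemma star_shaped:
  assumes "0 \<le> a" "a \<le> b" "b > 0"
  shows "h a \<le> a / b * h b"
proof -
  have "h ((1 - a / b) *\<^sub>R 0 + (a / b) *\<^sub>R b) \<le> (1 - a / b) * h 0 + (a / b) * h b"
    using assms by (intro convex_onD[OF convex]) auto
  thus ?thesis using assms zero by simp
qed

text \<open>Let sigma be \<open>h (v + d) / (v + d)\<close>. Then \<open>h v\<close> is at most v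
  times sigma and \<open>h u / u\<close> is at most sigma, and the two bounds add up.\<close>

lemma slope_increment:
  assumes "0 < u" "u \<le> v" "0 \<le> d"
  shows "h v + d * (h u / u) \<le> h (v + d)"
proof -
  have v: "h v \<le> v / (v + d) * h (v + d)" using assms by (intro star_shaped) auto
  have "h u \<le> u / (v + d) * h (v + d)" using assms by (intro star_shaped) auto
  hence "h u / u \<le> h (v + d) / (v + d)" using assms by (simp add: field_simps)
  hence "d * (h u / u) \<le> d * (h (v + d) / (v + d))" using assms by (intro mult_left_mono)
  hence "h v + d * (h u / u) \<le> (v + d) * (h (v + d) / (v + d))" using v
    unfolding times_divide_eq_left times_divide_eq_right distrib_right add_divide_distrib by linarith
  thus ?thesis using assms by simp
qed

lemma superadditive:
  assumes "0 \<le> a" "0 \<le> b"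
  shows "h a + h b \<le> h (a + b)"
proof (cases "a = 0 \<or> b = 0")
  case True thus ?thesis using zero by auto
next
  case False
  hence "h a \<le> a / (a + b) * h (a + b)" "h b \<le> b / (a + b) * h (a + b)"
    using assms by (intro star_shaped; simp)+
  moreover have "a / (a + b) * h (a + b) + b / (a + b) * h (a + b) = h (a + b)"
    using False assms by (simp add: add_divide_distrib[symmetric] distrib_right[symmetric])
  ultimately show ?thesis by linarith
qed

lemma mono: "0 \<le> a \<Longrightarrow> a \<le> b \<Longrightarrow> h a \<le> h b"
  using superadditive[of a "b - a"] nonneg[of "b - a"] by simp

text \<open>Growth at the positive rate \<open>h 1\<close> makes the integrals finite and turns
  bounds on \<open>h (norm y)\<close> into bounds on \<open>norm y\<close>.\<close>

lemma linear_lower_bound: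
  assumes "t \<ge> 0"
  shows "h 1 * t - h 1 \<le> h t"
proof (cases "t \<ge> 1")
  case True
  thus ?thesis using slope_increment[of 1 1 "t - 1"] nonneg[of 1] by (simp add: algebra_simps)
next
  case False
  hence "h 1 * t \<le> h 1 * 1" using nonneg[of 1] by (intro mult_left_mono) auto
  thus ?thesis using nonneg[OF assms] by simp
qed

text \<open>The gain in \<open>h\<close> from adding \<open>\<eta>\<^sup>2\<close> under the root is of order \<open>sqrt (1 - k\<^sup>2)\<close>, whereas shrinking
  by \<open>k\<close> costs only \<open>- n * ln k\<close>, which is of order \<open>1 - k\<close>.\<close>

lemma shrink_gain:
  assumes "\<eta> > 0"
  obtains k g where "k > 0" "exp (- g) < k ^ n"
    "\<And>r. r \<ge> 0 \<Longrightarrow> h (k * r) + g \<le> h (sqrt (r\<^sup>2 + \<eta>\<^sup>2))"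
proof -
  define g0 where "g0 = h (\<eta> / 3)"
  define c where "c = h (\<eta> / 2)"
  have gc: "g0 > 0" "c > 0" using assms pos by (auto simp: g0_def c_def)
  \<comment> \<open>Together with \<open>e \<le> 1\<close> and \<open>m \<ge> e / 2\<close>, these
    bounds keep the price \<open>n * e\<^sup>2\<close> of shrinking below both candidates
    \<open>g0\<close> and \<open>2 * m * c\<close> for the gain.\<close>
  define e where "e = min 1 (min (g0 / (n + 1)) (c / (n + 1)))"
  have e: "e > 0" "e \<le> 1" using gc by (auto simp: e_def)
  have "e \<le> g0 / (n + 1)" "e \<le> c / (n + 1)" by (auto simp: e_def)
  hence en: "e * (n + 1) \<le> g0" "e * (n + 1) \<le> c" by (simp_all only: pos_le_divide_eq of_nat_0_less_iff zero_less_Suc Suc_eq_plus1[symmetric])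
  \<comment> \<open>Chosen so that \<open>1 + e\<^sup>2 \<le> exp (e\<^sup>2)\<close> bounds
    \<open>k ^ n\<close> below by \<open>exp (- (n * e\<^sup>2))\<close>, while the complementary
    \<open>m\<close> is still at least \<open>e / 2\<close>.\<close>
  define k where "k = 1 / (1 + e\<^sup>2)"
  define m where "m = sqrt (1 - k\<^sup>2)"
  have e2: "e\<^sup>2 \<le> 1" using e by (simp add: power_le_one)
  have k: "k \<ge> 1/2" "k < 1" using e e2 frac_le[of 1 1 "1 + e\<^sup>2" 2]
    by (auto simp: k_def divide_less_eq add_pos_pos)
  have "1 - k\<^sup>2 \<ge> 1 - k" using k by (simp add: power2_eq_square)
  also have "1 - k = e\<^sup>2 / (1 + e\<^sup>2)" using e by (simp add: k_def field_simps add_nonneg_eq_0_iff)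
  also have "\<dots> \<ge> e\<^sup>2 / 2" using e e2 by (intro divide_left_mono) (auto simp: add_pos_nonneg)
  also have "e\<^sup>2 / 2 \<ge> (e / 2)\<^sup>2" by (simp add: power_divide)
  finally have m: "m \<ge> e / 2" unfolding m_def by (rule real_le_rsqrt)
  have km: "k\<^sup>2 + m\<^sup>2 = 1" using k by (simp add: m_def power_le_one)
  define g where "g = min g0 (2 * m * c)"
  have "e * (n * e) < g0"
  proof -
    have "e * (n * e) \<le> 1 * (n * e)" using e by (intro mult_right_mono) auto
    also have "\<dots> < g0" using e en by (simp add: algebra_simps)
    finally show ?thesis .
  qed
  moreover have "e * (n * e) < 2 * m * c"
  proof -
    have "e * (n * e) < e * c" using e en by (intro mult_strict_left_mono) (auto simp: algebra_simps)
    also have "\<dots> \<le> 2 * m * c" using m gc by (intro mult_right_mono) auto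
    finally show ?thesis .
  qed
  ultimately have g: "n * e\<^sup>2 < g" by (simp add: g_def power2_eq_square mult_ac)
  have "exp (- g) < exp (- (n * e\<^sup>2))" using g by simp
  also have "\<dots> = (exp (- e\<^sup>2)) ^ n" by (simp add: exp_of_nat_mult[symmetric])
  also have "\<dots> \<le> k ^ n"
  proof (intro power_mono)
    have "1 + e\<^sup>2 \<le> exp (e\<^sup>2)" by (rule exp_ge_add_one_self)
    thus "exp (- e\<^sup>2) \<le> k" using e
      by (simp add: k_def exp_minus inverse_eq_divide) (intro divide_left_mono, auto simp: add_pos_nonneg)
  qed simp
  finally have "exp (- g) < k ^ n" .
  \<comment> \<open>For \<open>r \<le> \<eta>\<close> the root exceeds \<open>r\<close> by at least
    \<open>\<eta> / 3\<close>, and superadditivity gives the gain \<open>g0\<close>. For larger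
    \<open>r\<close>, Cauchy-Schwarz with the unit vector (k, m) gives an increment
    \<open>m * \<eta>\<close>, over which \<open>h\<close> grows at least at its chord slope at
    \<open>\<eta> / 2\<close>; this is the gain \<open>2 * m * c\<close>.\<close>
  moreover have "h (k * r) + g \<le> h (sqrt (r\<^sup>2 + \<eta>\<^sup>2))" if r: "r \<ge> 0" for r
  proof (cases "r \<le> \<eta>")
    case True
    have kr: "k * r \<le> 1 * r" using r k by (intro mult_right_mono) auto
    have "(r + \<eta> / 3)\<^sup>2 \<le> r\<^sup>2 + \<eta>\<^sup>2"
    proof -
      have "r * \<eta> \<le> \<eta> * \<eta>" using True assms by (intro mult_right_mono) auto
      moreover have "\<eta> * \<eta> \<ge> 0" by simp
      moreover have "(r + \<eta> / 3)\<^sup>2 = r\<^sup>2 + 2 / 3 * (r * \<eta>) + \<eta> * \<eta> / 9"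
        by (simp add: power2_eq_square algebra_simps)
      ultimately show ?thesis unfolding power2_eq_square[of \<eta>] by linarith
    qed
    hence "r + \<eta> / 3 \<le> sqrt (r\<^sup>2 + \<eta>\<^sup>2)" by (rule real_le_rsqrt)
    hence "k * r + \<eta> / 3 \<le> sqrt (r\<^sup>2 + \<eta>\<^sup>2)" using kr by simp
    moreover have "h (k * r) + h (\<eta> / 3) \<le> h (k * r + \<eta> / 3)"
      using r k assms by (intro superadditive) auto
    moreover have "h (k * r + \<eta> / 3) \<le> h (sqrt (r\<^sup>2 + \<eta>\<^sup>2))"
      using calculation(1) r k assms by (intro mono) auto
    ultimately show ?thesis by (simp add: g_def g0_def)
  next
    case False
    have "(k * r + m * \<eta>)\<^sup>2 + (m * r - k * \<eta>)\<^sup>2 = (k\<^sup>2 + m\<^sup>2) * (r\<^sup>2 + \<eta>\<^sup>2)"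
      by (simp add: power2_eq_square algebra_simps)
    hence "(k * r + m * \<eta>)\<^sup>2 \<le> r\<^sup>2 + \<eta>\<^sup>2"
      using zero_le_power2[of "m * r - k * \<eta>"] unfolding km mult_1 by linarith
    hence le: "k * r + m * \<eta> \<le> sqrt (r\<^sup>2 + \<eta>\<^sup>2)" by (rule real_le_rsqrt)
    have "\<eta> / 2 \<le> k * r"
    proof -
      have "1 / 2 * \<eta> \<le> k * r" using False k assms by (intro mult_mono) auto
      thus ?thesis by simp
    qed
    hence "h (k * r) + (m * \<eta>) * (h (\<eta> / 2) / (\<eta> / 2)) \<le> h (k * r + m * \<eta>)"
      using assms m e by (intro slope_increment) auto
    also have "\<dots> \<le> h (sqrt (r\<^sup>2 + \<eta>\<^sup>2))" using le r k m e assms by (intro mono) auto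
    finally show ?thesis using assms by (simp add: g_def c_def field_simps)
  qed
  ultimately show ?thesis using that[of k g] k by auto
qed

end

section \<open>The functions psi_s as convex profiles\<close>

lemma psi_has_derivative:
  assumes "s > 0"
  shows "(psi s has_real_derivative 2 * t / (s + sqrt (s\<^sup>2 + (2 * t)\<^sup>2))) (at t)"
proof -
  define w where "w = sqrt (1 + 4 * (t / s)\<^sup>2)"
  have pos: "1 + 4 * (t / s)\<^sup>2 > 0" by (rule add_pos_nonneg) auto
  have w: "w > 0" using pos by (simp add: w_def)
  have sw: "sqrt (s\<^sup>2 + (2 * t)\<^sup>2) = s * w"
  proof -
    have "s\<^sup>2 + (2 * t)\<^sup>2 = s\<^sup>2 * (1 + 4 * (t / s)\<^sup>2)" using assms by (simp add: field_simps power2_eq_square)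
    thus ?thesis using assms by (simp add: w_def real_sqrt_mult)
  qed
  have dw: "((\<lambda>t. sqrt (1 + 4 * (t / s)\<^sup>2)) has_real_derivative 4 * t / (s\<^sup>2 * w)) (at t)"
    unfolding w_def using assms pos
    by (auto intro!: derivative_eq_intros simp: power2_eq_square divide_simps)
  have w1: "(1 + sqrt (1 + 4 * (t / s)\<^sup>2)) / 2 > 0"
    by (rule divide_pos_pos[OF add_pos_pos[OF zero_less_one real_sqrt_gt_zero[OF pos]]]) simp
  have "((\<lambda>t. s / 2 * (sqrt (1 + 4 * (t / s)\<^sup>2) - ln ((1 + sqrt (1 + 4 * (t / s)\<^sup>2)) / 2) - 1))
    has_real_derivative s / 2 * (4 * t / (s\<^sup>2 * w) - (4 * t / (s\<^sup>2 * w) / 2) / ((1 + w) / 2))) (at t)"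
  proof -
    have "((\<lambda>t. (1 + sqrt (1 + 4 * (t / s)\<^sup>2)) / 2) has_real_derivative 4 * t / (s\<^sup>2 * w) / 2) (at t)"
      using DERIV_cdivide[OF DERIV_add[OF DERIV_const[of 1] dw], of 2] by (simp only: add_0)
    from DERIV_cmult[OF DERIV_diff[OF DERIV_diff[OF dw DERIV_chain2[OF DERIV_ln_divide[OF w1] this]] DERIV_const[of 1]], of "s / 2"]
    show ?thesis unfolding w_def by (simp only: diff_0_right) (simp add: mult_ac)
  qed
  \<comment> \<open>The difference contains the factor 1 - 1 / (1 + w) = w / (1 + w), which cancels
    the \<open>w\<close> in the denominator.\<close>
  moreover have "s / 2 * (4 * t / (s\<^sup>2 * w) - (4 * t / (s\<^sup>2 * w) / 2) / ((1 + w) / 2))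
     = 2 * t / (s + s * w)"
  proof -
    have "1 + w \<noteq> 0" "w \<noteq> 0" "s \<noteq> 0" using w assms by auto
    moreover have "s + s * w = s * (1 + w)" by (simp add: algebra_simps)
    ultimately show ?thesis by (simp add: divide_simps power2_eq_square) (simp add: algebra_simps)
  qed
  moreover have "psi s = (\<lambda>t. s / 2 * (sqrt (1 + 4 * (t / s)\<^sup>2) - ln ((1 + sqrt (1 + 4 * (t / s)\<^sup>2)) / 2) - 1))"
    using assms by (auto simp: psi_def)
  ultimately show ?thesis by (simp only: sw)
qed

text \<open>After cross-multiplication the terms with \<open>s\<close> compare directly, and the
  squares of the two terms with a root differ by
  \<open>(u\<^sup>2 - t\<^sup>2) * s\<^sup>2\<close>.\<close>

lemma psi_slope_mono:
  fixes s :: real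
  assumes "s > 0" "0 \<le> t" "t \<le> u"
  shows "2 * t / (s + sqrt (s\<^sup>2 + (2 * t)\<^sup>2)) \<le> 2 * u / (s + sqrt (s\<^sup>2 + (2 * u)\<^sup>2))"
proof -
  have "t * sqrt (s\<^sup>2 + (2 * u)\<^sup>2) = sqrt (t\<^sup>2 * (s\<^sup>2 + (2 * u)\<^sup>2))"
    using assms by (simp add: real_sqrt_mult)
  also have "\<dots> \<le> sqrt (u\<^sup>2 * (s\<^sup>2 + (2 * t)\<^sup>2))"
  proof -
    have "t\<^sup>2 * s\<^sup>2 \<le> u\<^sup>2 * s\<^sup>2" using assms by (intro mult_right_mono power_mono) auto
    thus ?thesis by (simp add: algebra_simps power_mult_distrib)
  qed
  also have "\<dots> = u * sqrt (s\<^sup>2 + (2 * t)\<^sup>2)"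
    using assms by (simp add: real_sqrt_mult)
  finally have "t * sqrt (s\<^sup>2 + (2 * u)\<^sup>2) \<le> u * sqrt (s\<^sup>2 + (2 * t)\<^sup>2)" .
  moreover have "t * s \<le> u * s" using assms by (intro mult_right_mono) auto
  ultimately have "t * (s + sqrt (s\<^sup>2 + (2 * u)\<^sup>2)) \<le> u * (s + sqrt (s\<^sup>2 + (2 * t)\<^sup>2))"
    by (simp add: algebra_simps)
  moreover have "s + sqrt (s\<^sup>2 + (2 * t)\<^sup>2) > 0" "s + sqrt (s\<^sup>2 + (2 * u)\<^sup>2) > 0"
    using assms by (auto intro: add_pos_nonneg)
  ultimately show ?thesis by (simp add: frac_le_eq divide_simps)
qed

lemma continuous_on_psi: "s \<ge> 0 \<Longrightarrow> continuous_on S (psi s)"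
proof (cases "s = 0")
  case True thus ?thesis by (simp add: psi_def[abs_def])
next
  case False
  have "1 + sqrt (1 + 4 * (t / s)\<^sup>2) > 0" for t by (rule add_pos_nonneg) auto
  hence "(1 + sqrt (1 + 4 * (t / s)\<^sup>2)) / 2 \<noteq> 0" for t by (metis divide_eq_0_iff less_irrefl zero_neq_numeral)
  thus ?thesis using False unfolding psi_def[abs_def] by (auto intro!: continuous_intros)
qed

lemma convex_profile_psi:
  assumes "s \<ge> 0"
  shows "convex_profile (psi s)"
proof (cases "s = 0")
  case True
  hence "psi s = (\<lambda>t. t)" by (auto simp: psi_def)
  thus ?thesis by unfold_locales (auto simp: convex_on_def)
next
  case False
  hence s: "s > 0" using assms by simp
  let ?d = "\<lambda>t. 2 * t / (s + sqrt (s\<^sup>2 + (2 * t)\<^sup>2))"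
  have zero: "psi s 0 = 0" by (simp add: psi_def)
  have conv: "convex_on {0..} (psi s)"
  proof (rule convex_on_realI[where f' = ?d])
    show "connected {0::real..}" by simp
    show "?d t \<le> ?d u" if "t \<in> {0..}" "u \<in> {0..}" "t \<le> u" for t u
      using psi_slope_mono[OF s] that by simp
  qed (rule psi_has_derivative[OF s])
  \<comment> \<open>The slope lies in (0, 1] at positive arguments, so the mean value theorem gives
    both bounds at once.\<close>
  have diff: "psi s t \<le> t \<and> psi s t > 0" if t: "t > 0" for t
  proof -
    obtain z where z: "z > 0" "z < t" "psi s t - psi s 0 = (t - 0) * ?d z"
      using MVT2[OF t psi_has_derivative[OF s]] by blast
    have "2 * z \<le> sqrt (s\<^sup>2 + (2 * z)\<^sup>2)" by (rule real_le_rsqrt) simp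
    hence "?d z > 0" "?d z \<le> 1" using s z by auto
    hence "t * ?d z > 0" "t * ?d z \<le> t * 1" using t by (intro mult_pos_pos mult_left_mono; simp)+
    thus ?thesis using z(3) zero by auto
  qed
  show ?thesis
    by unfold_locales (use zero conv diff continuous_on_psi assms in \<open>auto simp: le_less\<close>)
qed

subsection \<open>The integral of an ellipsoidal function\<close>

lemma nn_integral_translate:
  fixes g :: "'a::euclidean_space \<Rightarrow> ennreal"
  assumes [measurable]: "g \<in> borel_measurable borel"
  shows "(\<integral>\<^sup>+x. g (a + x) \<partial>lborel) = (\<integral>\<^sup>+x. g x \<partial>lborel)"
  using nn_integral_distr[of "(+) a" lborel borel g] lborel_distr_plus[of a] by simp

lemma nn_integral_reflect:
  fixes g :: "'a::euclidean_space \<Rightarrow> ennreal"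
  assumes [measurable]: "g \<in> borel_measurable borel"
  shows "(\<integral>\<^sup>+x. g (a - x) \<partial>lborel) = (\<integral>\<^sup>+x. g x \<partial>lborel)"
proof -
  have "(\<integral>\<^sup>+x. g x \<partial>lborel) = (\<integral>\<^sup>+x. g (a + (-1) *\<^sub>R x) \<partial>lborel)"
    by (subst lborel_affine[of "-1" a]) (simp_all add: nn_integral_density nn_integral_distr)
  thus ?thesis by simp
qed

text \<open>Uniqueness of Haar measure, by the usual Tonelli argument, applied to the image of Lebesgue
  measure under \<open>L\<close>. (The library formula for \<open>|det L|\<close> needs a well-ordered index type.)\<close>

lemma nn_integral_linear_bij_proportional:
  fixes f g :: "'a::euclidean_space \<Rightarrow> ennreal"
  assumes [measurable]: "f \<in> borel_measurable borel" "g \<in> borel_measurable borel"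
    and L: "linear L" and K: "\<And>x. L (K x) = x"
  shows "(\<integral>\<^sup>+x. f x \<partial>lborel) * (\<integral>\<^sup>+x. g (L x) \<partial>lborel) = (\<integral>\<^sup>+x. g x \<partial>lborel) * (\<integral>\<^sup>+x. f (L x) \<partial>lborel)"
proof -
  have [measurable]: "L \<in> borel_measurable borel"
    using L by (intro borel_measurable_continuous_onI linear_continuous_on) (simp add: linear_conv_bounded_linear)
  interpret L: linear L by (rule L)
  have "(\<integral>\<^sup>+x. f x \<partial>lborel) * (\<integral>\<^sup>+y. g (L y) \<partial>lborel) = (\<integral>\<^sup>+x. f x * (\<integral>\<^sup>+y. g (L y) \<partial>lborel) \<partial>lborel)"
    by (simp add: nn_integral_multc)
  \<comment> \<open>Shifting \<open>y\<close> by \<open>K x\<close> turns \<open>L y\<close> into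
    \<open>x + L y\<close>. After Tonelli and a shift in \<open>x\<close>, the identity
    \<open>x - L y = L (K x - y)\<close> frees the inner integral of \<open>x\<close> in the same
    way.\<close>
  also have "\<dots> = (\<integral>\<^sup>+x. f x * (\<integral>\<^sup>+y. g (L (K x + y)) \<partial>lborel) \<partial>lborel)"
    using nn_integral_translate[of "\<lambda>y. g (L y)"] by simp
  also have "\<dots> = (\<integral>\<^sup>+x. (\<integral>\<^sup>+y. f x * g (x + L y) \<partial>lborel) \<partial>lborel)"
    by (simp add: nn_integral_cmult L.add K)
  also have "\<dots> = (\<integral>\<^sup>+y. (\<integral>\<^sup>+x. f x * g (x + L y) \<partial>lborel) \<partial>lborel)"
    by (rule lborel_pair.Fubini') simp
  also have "\<dots> = (\<integral>\<^sup>+y. (\<integral>\<^sup>+x. f (x - L y) * g x \<partial>lborel) \<partial>lborel)"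
  proof (rule nn_integral_cong)
    fix y
    show "(\<integral>\<^sup>+x. f x * g (x + L y) \<partial>lborel) = (\<integral>\<^sup>+x. f (x - L y) * g x \<partial>lborel)"
      using nn_integral_translate[of "\<lambda>x. f (x - L y) * g x" "L y"] by (simp add: add.commute)
  qed
  also have "\<dots> = (\<integral>\<^sup>+x. (\<integral>\<^sup>+y. f (x - L y) * g x \<partial>lborel) \<partial>lborel)"
    by (rule lborel_pair.Fubini') simp
  also have "\<dots> = (\<integral>\<^sup>+x. g x * (\<integral>\<^sup>+y. f (L (K x - y)) \<partial>lborel) \<partial>lborel)"
    by (simp add: nn_integral_cmult mult.commute L.diff K)
  also have "\<dots> = (\<integral>\<^sup>+x. g x * (\<integral>\<^sup>+y. f (L y) \<partial>lborel) \<partial>lborel)"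
    using nn_integral_reflect[of "\<lambda>y. f (L y)"] by simp
  also have "\<dots> = (\<integral>\<^sup>+x. g x \<partial>lborel) * (\<integral>\<^sup>+x. f (L x) \<partial>lborel)"
    by (simp add: nn_integral_multc)
  finally show ?thesis .
qed

lemma borel_measurable_matrix_vector_mult [measurable]:
  fixes A :: "real^'n^'m"
  shows "(*v) A \<in> borel_measurable borel"
  by (intro borel_measurable_continuous_onI linear_continuous_on) (simp add: linear_conv_bounded_linear[symmetric])

section \<open>Integrability of exponentials and the diagonal substitution\<close>

lemma nn_integral_exp_abs:
  assumes "c > 0"
  shows "(\<integral>\<^sup>+x. ennreal (exp (- c * \<bar>x\<bar>)) \<partial>lborel) < \<infinity>"
proof -
  define e where "e x = ennreal (exp (- c * x)) * indicator {0..} x" for x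
  have [measurable]: "e \<in> borel_measurable borel" unfolding e_def by measurable
  have "(\<integral>\<^sup>+x. e x \<partial>lborel) = ennreal (0 - - exp (- c * 0) / c)"
    unfolding e_def
  proof (rule nn_integral_FTC_atLeast[where F = "\<lambda>x. - exp (- c * x) / c"])
    have "filterlim (\<lambda>x. - c * x) at_bot at_top"
      using assms filterlim_tendsto_neg_mult_at_bot[OF tendsto_const _ filterlim_ident, of "- c"] by simp
    from filterlim_compose[OF exp_at_bot this]
    have "((\<lambda>x. - exp (- c * x) / c) \<longlongrightarrow> - 0 / c) at_top" by (intro tendsto_intros) (use assms in auto)
    thus "((\<lambda>x. - exp (- c * x) / c) \<longlongrightarrow> 0) at_top" by simp
  qed (use assms in \<open>auto intro!: derivative_eq_intros\<close>)
  hence e: "(\<integral>\<^sup>+x. e x \<partial>lborel) < \<infinity>" by simp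
  have "(\<integral>\<^sup>+x. ennreal (exp (- c * \<bar>x\<bar>)) \<partial>lborel) \<le> (\<integral>\<^sup>+x. e x + e (0 - x) \<partial>lborel)"
    by (intro nn_integral_mono) (auto simp: e_def indicator_def)
  also have "\<dots> = (\<integral>\<^sup>+x. e x \<partial>lborel) + (\<integral>\<^sup>+x. e x \<partial>lborel)"
    using nn_integral_reflect[of e 0] by (subst nn_integral_add) auto
  also have "\<dots> < \<infinity>" using e by simp
  finally show ?thesis .
qed

lemma nn_integral_exp_norm:
  fixes c :: real
  assumes "c > 0"
  shows "(\<integral>\<^sup>+x. ennreal (exp (- c * norm (x :: 'a::euclidean_space))) \<partial>lborel) < \<infinity>"
proof -
  \<comment> \<open>The norm dominates every absolute coordinate, hence their mean; with this rate
    the majorant is a product of one-dimensional functions.\<close>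
  let ?q = "c / DIM('a)"
  have "(\<integral>\<^sup>+x. ennreal (exp (- c * norm (x::'a))) \<partial>lborel)
      \<le> (\<integral>\<^sup>+x. (\<Prod>b\<in>Basis. ennreal (exp (- ?q * \<bar>(x::'a) \<bullet> b\<bar>))) \<partial>lborel)"
  proof (intro nn_integral_mono)
    fix x :: 'a
    have "(\<Sum>b\<in>Basis. \<bar>x \<bullet> b\<bar>) \<le> (\<Sum>b\<in>(Basis::'a set). norm x)"
      by (intro sum_mono Basis_le_norm)
    hence "?q * (\<Sum>b\<in>Basis. \<bar>x \<bullet> b\<bar>) \<le> ?q * (DIM('a) * norm x)" using assms by (intro mult_left_mono) auto
    hence "exp (- c * norm x) \<le> exp (\<Sum>b\<in>Basis. - ?q * \<bar>x \<bullet> b\<bar>)"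
      by (simp add: sum_distrib_left sum_negf)
    also have "\<dots> = (\<Prod>b\<in>Basis. exp (- ?q * \<bar>x \<bullet> b\<bar>))" by (rule exp_sum) simp
    finally show "ennreal (exp (- c * norm x)) \<le> (\<Prod>b\<in>Basis. ennreal (exp (- ?q * \<bar>x \<bullet> b\<bar>)))"
      by (simp add: prod_ennreal ennreal_leI)
  qed
  also have "\<dots> = (\<Prod>b\<in>(Basis::'a set). (\<integral>\<^sup>+x. ennreal (exp (- ?q * \<bar>x\<bar>)) \<partial>lborel))"
    by (rule nn_integral_lborel_prod) auto
  also have "\<dots> < \<infinity>"
    using nn_integral_exp_abs[of ?q] assms by (simp add: ennreal_prod_eq_top less_top[symmetric] power_eq_top_ennreal)
  finally show ?thesis .
qed

lemma nn_integral_diagonal: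
  fixes g :: "real^'n \<Rightarrow> ennreal"
  assumes [measurable]: "g \<in> borel_measurable borel" and c: "\<And>i. c i > 0"
  shows "(\<integral>\<^sup>+x. g x \<partial>lborel) =
    ennreal (\<Prod>i\<in>UNIV. c i) * (\<integral>\<^sup>+x. g ((\<chi> i j. if i = j then c i else 0) *v x) \<partial>lborel)"
proof -
  let ?D = "(\<chi> i j. if i = j then c i else 0) :: real^'n^'n"
  \<comment> \<open>\<open>lborel_affine_euclidean\<close> takes its scalings per basis vector, so
    an index is recovered from its axis vector; injectivity of \<open>axis\<close> makes the choice
    unique.\<close>
  let ?c = "\<lambda>b::real^'n. c (SOME i. b = axis i 1)"
  have cax: "?c (axis i 1) = c i" for i by (simp add: axis_eq_axis)
  have D: "?D *v x = (\<chi> i. c i * x $ i)" for x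
  proof -
    have "(\<Sum>j\<in>UNIV. (if i = j then c i else 0) * x $ j) = (\<Sum>j\<in>UNIV. if j = i then c i * x $ i else 0)" for i
      by (intro sum.cong) auto
    thus ?thesis by (simp add: matrix_vector_mult_def)
  qed
  have Beq: "(Basis :: (real^'n) set) = range (\<lambda>i. axis i 1)" by (auto simp: Basis_vec_def)
  have inj: "inj (\<lambda>i::'n. axis i 1 :: real^'n)" by (auto simp: inj_on_def axis_eq_axis)
  have T: "0 + (\<Sum>j\<in>Basis. (?c j * (x \<bullet> j)) *\<^sub>R j) = ?D *v x" for x
  proof -
    have "(\<Sum>j\<in>Basis. (?c j * (x \<bullet> j)) *\<^sub>R j) = (\<Sum>i\<in>UNIV. (c i * x $ i) *\<^sub>R axis i 1)"
      unfolding Beq sum.reindex[OF inj] by (simp only: o_def cax inner_axis inner_real_def mult_1_right)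
    also have "\<dots> = (\<chi> i. c i * x $ i)"
      by (simp add: vec_eq_iff axis_def if_distrib cong: if_cong)
    finally show ?thesis by (simp only: D add_0)
  qed
  have P: "(\<Prod>j\<in>Basis. \<bar>?c j\<bar>) = (\<Prod>i\<in>UNIV. c i)"
    unfolding Beq using c by (subst prod.reindex[OF inj]) (simp add: cax abs_of_pos)
  have "lborel = density (distr lborel borel (\<lambda>x. ?D *v x)) (\<lambda>_. ennreal (\<Prod>i\<in>UNIV. c i))"
    using lborel_affine_euclidean[of ?c 0] c unfolding T P by (simp add: less_imp_neq[THEN not_sym])
  hence "(\<integral>\<^sup>+x. g x \<partial>lborel) = (\<integral>\<^sup>+x. g x \<partial>density (distr lborel borel (\<lambda>x. ?D *v x)) (\<lambda>_. ennreal (\<Prod>i\<in>UNIV. c i)))"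
    by simp
  also have "\<dots> = ennreal (\<Prod>i\<in>UNIV. c i) * (\<integral>\<^sup>+x. g (?D *v x) \<partial>lborel)"
    by (simp add: nn_integral_density nn_integral_distr nn_integral_cmult)
  finally show ?thesis .
qed

lemma abs_det_orthogonal: "orthogonal_matrix (U::real^'n^'n) \<Longrightarrow> \<bar>det U\<bar> = 1"
  using det_orthogonal_matrix[of U] by auto

section \<open>The integral of a member of the class\<close>

context convex_profile
begin

lemma borel_measurable_profile [measurable]:
  fixes f :: "'b \<Rightarrow> 'a::real_normed_vector"
  assumes [measurable]: "f \<in> borel_measurable M"
  shows "(\<lambda>x. h (norm (f x))) \<in> borel_measurable M"
proof -
  have "continuous_on UNIV (\<lambda>y::'a. h (norm y))"
    by (intro continuous_on_compose2[OF continuous]) (auto intro: continuous_intros)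
  hence "(\<lambda>y::'a. h (norm y)) \<in> borel_measurable borel" by (rule borel_measurable_continuous_onI)
  thus ?thesis by measurable
qed

text \<open>The factor common to the integrals of all members in a given dimension, which the type
  argument fixes. Comparing integrals means cancelling it, hence the two facts that follow.\<close>

definition mass :: "('n::finite) itself \<Rightarrow> ennreal" where
  "mass _ = (\<integral>\<^sup>+x. ennreal (exp (- h (norm (x::real^'n)))) \<partial>lborel)"

lemma mass_pos: "mass TYPE('n::finite) > 0"
proof -
  have "mass TYPE('n) \<noteq> 0" unfolding mass_def by (subst nn_integral_0_iff) auto
  thus ?thesis by (simp add: zero_less_iff_neq_zero)
qed

lemma mass_finite: "mass TYPE('n::finite) < \<infinity>"
proof -
  have "mass TYPE('n) \<le> (\<integral>\<^sup>+x. ennreal (exp (h 1)) * ennreal (exp (- h 1 * norm (x::real^'n))) \<partial>lborel)"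
    unfolding mass_def
  proof (rule nn_integral_mono)
    fix x :: "real^'n"
    show "ennreal (exp (- h (norm x))) \<le> ennreal (exp (h 1)) * ennreal (exp (- h 1 * norm x))"
      using linear_lower_bound[of "norm x"] by (simp add: ennreal_mult'[symmetric] exp_add[symmetric])
  qed
  also have "\<dots> = ennreal (exp (h 1)) * (\<integral>\<^sup>+x. ennreal (exp (- h 1 * norm (x::real^'n))) \<partial>lborel)"
    by (rule nn_integral_cmult) simp
  also have "\<dots> < \<infinity>" using nn_integral_exp_norm[of "h 1", where 'a="real^'n"] pos[of 1]
    by (simp add: ennreal_mult_less_top)
  finally show ?thesis .
qed

text \<open>Proportionality is tested against \<open>exp (- h (norm x))\<close>, which
  \<open>U\<close> leaves unchanged and whose integral is positive and finite; so the factor of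
  proportionality is 1.\<close>

lemma nn_integral_orthogonal_matrix:
  fixes U :: "real^'n^'n"
  assumes [measurable]: "g \<in> borel_measurable borel" and U: "orthogonal_matrix U"
  shows "(\<integral>\<^sup>+x. g (U *v x) \<partial>lborel) = (\<integral>\<^sup>+x. g x \<partial>lborel)"
proof -
  have "U *v (transpose U *v x) = x" for x
    using U by (simp add: matrix_vector_mul_assoc orthogonal_matrix_def del: transpose_matrix_vector)
  from nn_integral_linear_bij_proportional[of "\<lambda>x. ennreal (exp (- h (norm x)))" g "(*v) U" "(*v) (transpose U)", OF _ _ _ this]
  have "mass TYPE('n) * (\<integral>\<^sup>+x. g (U *v x) \<partial>lborel) = mass TYPE('n) * (\<integral>\<^sup>+x. g x \<partial>lborel)"
    by (simp add: norm_orthogonal_matrix[OF U] mass_def mult.commute)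
  thus ?thesis using mass_pos[where 'n='n] mass_finite[where 'n='n] by (auto simp: ennreal_mult_cancel_left)
qed

text \<open>In the polar form of \<open>A\<close> the outer orthogonal factors do not affect the
  norm, the inner one disappears by rotation invariance, and the diagonal one contributes the
  product of the \<open>c i\<close>, which is |det A|. The shift \<open>b\<close> is the image of a
  point and disappears by translation.\<close>

lemma nn_integral_profile:
  fixes A :: "real^'n^'n"
  assumes A: "invertible A"
  shows "(\<integral>\<^sup>+x. ennreal (exp (\<beta> - h (norm (A *v x - b)))) \<partial>lborel) = ennreal (exp \<beta> / \<bar>det A\<bar>) * mass TYPE('n)"
proof -
  obtain U Q c where U: "orthogonal_matrix U" and Q: "orthogonal_matrix Q" and c: "\<And>i. c i > 0"
    and UA: "U ** A = transpose Q ** (\<chi> i j. if i = j then c i else 0) ** Q"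
    using invertible_matrix_polar[OF A] by blast
  let ?D = "(\<chi> i j. if i = j then c i else 0) :: real^'n^'n"
  let ?p = "\<Prod>i\<in>UNIV. c i"
  have p: "?p > 0" using c by (simp add: prod_pos)
  have c0: "c i \<noteq> 0" for i using c[of i] by simp
  have "\<bar>det (U ** A)\<bar> = \<bar>det (transpose Q ** ?D ** Q)\<bar>" by (simp add: UA)
  hence "\<bar>det A\<bar> = \<bar>det ?D\<bar>" using U Q by (simp add: det_mul abs_mult abs_det_orthogonal)
  also have "det ?D = ?p" by (subst det_diagonal) auto
  finally have dA: "\<bar>det A\<bar> = ?p" using p by simp
  have nA: "norm (A *v x) = norm (?D *v (Q *v x))" for x
  proof -
    have "norm (A *v x) = norm (U *v (A *v x))" by (simp add: norm_orthogonal_matrix U)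
    also have "U *v (A *v x) = transpose Q *v (?D *v (Q *v x))"
      by (simp only: matrix_vector_mul_assoc UA matrix_mul_assoc)
    also have "norm \<dots> = norm (?D *v (Q *v x))"
      using Q by (intro norm_orthogonal_matrix) simp
    finally show ?thesis .
  qed
  obtain a where a: "A *v a = b" using A
    by (metis invertible_def matrix_vector_mul_assoc matrix_vector_mul_lid)
  have "(\<integral>\<^sup>+x. ennreal (exp (\<beta> - h (norm (A *v x - b)))) \<partial>lborel)
      = (\<integral>\<^sup>+x. ennreal (exp \<beta>) * ennreal (exp (- h (norm (A *v (x - a))))) \<partial>lborel)"
    by (intro nn_integral_cong) (simp add: a ennreal_mult'[symmetric] exp_add[symmetric] matrix_vector_mult_diff_distrib)
  also have "\<dots> = ennreal (exp \<beta>) * (\<integral>\<^sup>+x. ennreal (exp (- h (norm (A *v x)))) \<partial>lborel)"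
    using nn_integral_translate[of "\<lambda>x. ennreal (exp (- h (norm (A *v x))))" "- a"] by (simp add: nn_integral_cmult)
  also have "(\<integral>\<^sup>+x. ennreal (exp (- h (norm (A *v x)))) \<partial>lborel) = (\<integral>\<^sup>+x. ennreal (exp (- h (norm (?D *v x)))) \<partial>lborel)"
    using nn_integral_orthogonal_matrix[OF _ Q, of "\<lambda>x. ennreal (exp (- h (norm (?D *v x))))"] by (simp add: nA)
  also have "\<dots> = ennreal (1 / ?p) * (ennreal ?p * (\<integral>\<^sup>+x. ennreal (exp (- h (norm (?D *v x)))) \<partial>lborel))"
    using p by (simp add: mult.assoc[symmetric] ennreal_mult'[symmetric] c0)
  also have "ennreal ?p * (\<integral>\<^sup>+x. ennreal (exp (- h (norm (?D *v x)))) \<partial>lborel) = mass TYPE('n)"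
    unfolding mass_def
    using nn_integral_diagonal[of "\<lambda>x. ennreal (exp (- h (norm x)))" c] c by simp
  finally show ?thesis using p by (simp add: dA mult.assoc[symmetric] ennreal_mult'[symmetric])
qed

end

subsection \<open>Uniqueness\<close>

text \<open>Factorwise AM-GM with its equality case: ((1 + c) / 2)^2 = c + ((1 - c) / 2)^2, so a
  single factor other than 1 makes the squared product strictly larger.\<close>

lemma prod_midpoint_le_imp_one:
  fixes c :: "'a::finite \<Rightarrow> real"
  assumes c: "\<And>i. c i > 0" and le: "(\<Prod>i\<in>UNIV. (1 + c i) / 2)\<^sup>2 \<le> (\<Prod>i\<in>UNIV. c i)"
  shows "c j = 1"
proof (rule ccontr)
  assume j: "c j \<noteq> 1"
  let ?m = "\<lambda>i. ((1 + c i) / 2)\<^sup>2"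
  have m: "?m i = c i + ((1 - c i) / 2)\<^sup>2" for i by (simp add: power2_eq_square field_simps)
  have cj: "c j < ?m j" using j unfolding m by simp
  have "(\<Prod>i\<in>UNIV. c i) = c j * (\<Prod>i\<in>UNIV - {j}. c i)" by (rule prod.remove) auto
  also have "\<dots> < ?m j * (\<Prod>i\<in>UNIV - {j}. c i)"
    using cj c by (intro mult_strict_right_mono prod_pos) auto
  also have "\<dots> \<le> ?m j * (\<Prod>i\<in>UNIV - {j}. ?m i)"
    using c by (intro mult_left_mono prod_mono) (auto simp: m less_imp_le)
  also have "\<dots> = (\<Prod>i\<in>UNIV. ?m i)" by (rule prod.remove[symmetric]) auto
  also have "\<dots> = (\<Prod>i\<in>UNIV. (1 + c i) / 2)\<^sup>2" by (simp add: prod_power_distrib)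
  finally show False using le by simp
qed

text \<open>Relative to |det A|, the absolute determinants of the midpoint and of \<open>B\<close>
  are the products of the \<open>(1 + c i) / 2\<close> and of the \<open>c i\<close>. The
  determinant condition thus becomes the hypothesis of
  \<open>prod_midpoint_le_imp_one\<close>.\<close>

lemma det_rotated_midpoint:
  fixes A B :: "real^'n^'n"
  assumes A: "invertible A" and B: "invertible B"
  obtains U where "orthogonal_matrix U" "invertible ((1/2) *\<^sub>R (A + U ** B))"
    "(det ((1/2) *\<^sub>R (A + U ** B)))\<^sup>2 \<le> \<bar>det A\<bar> * \<bar>det B\<bar> \<longrightarrow> U ** B = A"
proof -
  obtain N where N: "A ** N = mat 1" "N ** A = mat 1" using A by (auto simp: invertible_def)
  have "invertible N" using N by (auto simp: invertible_def)
  hence BN: "invertible (B ** N)" using B by (rule invertible_mult[rotated])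
  obtain U Q c where U: "orthogonal_matrix U" and Q: "orthogonal_matrix Q" and c: "\<And>i. c i > 0"
    and eq: "U ** (B ** N) = transpose Q ** (\<chi> i j. if i = j then c i else 0) ** Q"
    using invertible_matrix_polar[OF BN] by blast
  let ?D = "(\<chi> i j. if i = j then c i else 0) :: real^'n^'n"
  let ?E = "(\<chi> i j. if i = j then (1 + c i) / 2 else 0) :: real^'n^'n"
  have QQ: "transpose Q ** Q = mat 1" using Q by (simp add: orthogonal_matrix_def)
  have UB: "U ** B = transpose Q ** ?D ** Q ** A"
  proof -
    have "U ** B = U ** (B ** (N ** A))" by (simp add: N)
    also have "\<dots> = (U ** (B ** N)) ** A" by (simp only: matrix_mul_assoc)
    finally show ?thesis by (simp only: eq)
  qed
  have E: "?E = (1/2) *\<^sub>R (mat 1 + ?D)" by (auto simp: vec_eq_iff mat_def field_simps)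
  have rdistrib: "(X + Y) ** Z = X ** Z + Y ** Z" for X Y Z :: "real^'n^'n"
    by (simp add: vec_eq_iff matrix_matrix_mult_def distrib_right sum.distrib)
  have mid: "(1/2) *\<^sub>R (A + U ** B) = transpose Q ** ?E ** Q ** A"
  proof -
    have "transpose Q ** ?E ** Q ** A = (1/2) *\<^sub>R (transpose Q ** (mat 1 + ?D) ** Q ** A)"
      unfolding E by (simp only: matrix_scalar_ac scalar_matrix_assoc[symmetric])
    also have "transpose Q ** (mat 1 + ?D) ** Q ** A = transpose Q ** Q ** A + transpose Q ** ?D ** Q ** A"
      by (simp only: matrix_add_ldistrib rdistrib matrix_mul_rid)
    finally show ?thesis by (simp add: UB QQ)
  qed
  have oQ: "\<bar>det (transpose Q)\<bar> = 1" "\<bar>det Q\<bar> = 1" using Q by (auto simp: abs_det_orthogonal)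
  let ?p = "\<Prod>i\<in>UNIV. (1 + c i) / 2"
  have pp: "?p > 0" using c by (intro prod_pos) (auto simp: add_pos_pos)
  have dmid: "\<bar>det ((1/2) *\<^sub>R (A + U ** B))\<bar> = ?p * \<bar>det A\<bar>"
  proof -
    have "det ?E = ?p" by (subst det_diagonal) auto
    thus ?thesis using pp oQ unfolding mid det_mul abs_mult by simp
  qed
  have dB: "\<bar>det B\<bar> = (\<Prod>i\<in>UNIV. c i) * \<bar>det A\<bar>"
  proof -
    have "\<bar>det (U ** B)\<bar> = \<bar>det ?D\<bar> * \<bar>det A\<bar>" using oQ unfolding UB det_mul abs_mult by simp
    moreover have "det ?D = (\<Prod>i\<in>UNIV. c i)" by (subst det_diagonal) auto
    moreover have "(\<Prod>i\<in>UNIV. c i) > 0" using c by (simp add: prod_pos)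
    ultimately show ?thesis using U by (simp add: det_mul abs_mult abs_det_orthogonal)
  qed
  have dA: "\<bar>det A\<bar> > 0" using A by (simp add: invertible_det_nz)
  show ?thesis
  proof
    show "invertible ((1/2) *\<^sub>R (A + U ** B))"
      using dmid pp dA unfolding invertible_det_nz by (metis abs_zero less_irrefl mult_pos_pos)
    show "(det ((1/2) *\<^sub>R (A + U ** B)))\<^sup>2 \<le> \<bar>det A\<bar> * \<bar>det B\<bar> \<longrightarrow> U ** B = A"
    proof
      assume "(det ((1/2) *\<^sub>R (A + U ** B)))\<^sup>2 \<le> \<bar>det A\<bar> * \<bar>det B\<bar>"
      hence "\<bar>det ((1/2) *\<^sub>R (A + U ** B))\<bar>\<^sup>2 \<le> \<bar>det A\<bar> * \<bar>det B\<bar>" by simp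
      hence "?p\<^sup>2 * \<bar>det A\<bar>\<^sup>2 \<le> (\<Prod>i\<in>UNIV. c i) * \<bar>det A\<bar>\<^sup>2"
        unfolding dmid dB power_mult_distrib by (simp only: power2_eq_square mult_ac)
      hence "?p\<^sup>2 \<le> (\<Prod>i\<in>UNIV. c i)" using dA by (simp add: mult_le_cancel_right)
      hence c1: "c i = 1" for i by (rule prod_midpoint_le_imp_one[OF c])
      have "?D = mat 1" by (auto simp: vec_eq_iff mat_def c1)
      thus "U ** B = A" unfolding UB by (simp add: QQ)
    qed
  qed (rule U)
qed

section \<open>Covers, their cost, and how to improve them\<close>

context convex_profile
begin

text \<open>The center a enters as \<open>b\<close> = A a: for fixed \<open>x\<close>,
  \<open>A *v x - b\<close> is then linear in the pair (A, b), which a parametrization by a would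
  spoil.\<close>

definition covers :: "(real^'n \<Rightarrow> real) \<Rightarrow> real^'n^'n \<Rightarrow> real^'n \<Rightarrow> real \<Rightarrow> bool" where
  "covers f A b \<beta> \<longleftrightarrow> (\<forall>x. f x \<le> exp (\<beta> - h (norm (A *v x - b))))"

definition cost :: "real^'n^'n \<Rightarrow> real \<Rightarrow> real" where
  "cost A \<beta> = exp \<beta> / \<bar>det A\<bar>"

lemma covers_orthogonal:
  assumes "orthogonal_matrix U"
  shows "covers f (U ** A) (U *v b) \<beta> \<longleftrightarrow> covers f A b \<beta>"
proof -
  have "norm ((U ** A) *v x - U *v b) = norm (A *v x - b)" for x
    using norm_orthogonal_matrix[OF assms, of "A *v x - b"]
    by (simp add: matrix_vector_mul_assoc matrix_vector_mult_diff_distrib)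
  thus ?thesis by (simp add: covers_def)
qed

lemma covers_midpoint:
  assumes "covers f A b \<beta>" "covers f B c \<gamma>"
  shows "covers f ((1/2) *\<^sub>R (A + B)) ((1/2) *\<^sub>R (b + c)) ((\<beta> + \<gamma>) / 2)"
  unfolding covers_def
proof
  fix x
  let ?u = "norm (A *v x - b)" and ?v = "norm (B *v x - c)"
  let ?w = "norm (((1/2) *\<^sub>R (A + B)) *v x - (1/2) *\<^sub>R (b + c))"
  have "((1/2) *\<^sub>R (A + B)) *v x - (1/2) *\<^sub>R (b + c) = (1/2) *\<^sub>R ((A *v x - b) + (B *v x - c))"
    by (simp add: scaleR_matrix_vector_assoc[symmetric] matrix_vector_mult_add_rdistrib algebra_simps)
  hence "?w = norm ((A *v x - b) + (B *v x - c)) / 2" by simp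
  also have "\<dots> \<le> (?u + ?v) / 2" using norm_triangle_ineq by (intro divide_right_mono) auto
  finally have "h ?w \<le> h ((?u + ?v) / 2)" by (intro mono) auto
  also have "\<dots> = h ((1 - 1/2) *\<^sub>R ?u + (1/2) *\<^sub>R ?v)" by (simp add: field_simps)
  also have "\<dots> \<le> (1 - 1/2) * h ?u + (1/2) * h ?v"
    by (rule convex_onD[OF convex]) auto
  finally have w: "h ?w \<le> (h ?u + h ?v) / 2" by (simp add: field_simps)
  have "f x \<le> exp (\<beta> - h ?u)" "f x \<le> exp (\<gamma> - h ?v)" using assms by (auto simp: covers_def)
  \<comment> \<open>\<open>f x\<close> lies below both bounds, hence below the one with the smaller
    exponent, which is at most the mean of the two.\<close>
  hence "f x \<le> exp (min (\<beta> - h ?u) (\<gamma> - h ?v))" by (simp add: min_def)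
  also have "\<dots> \<le> exp ((\<beta> + \<gamma>) / 2 - h ?w)" using w by (simp add: min_def field_simps)
  finally show "f x \<le> exp ((\<beta> + \<gamma>) / 2 - h ?w)" .
qed

text \<open>Of the distances from a point to \<open>b\<close> and to \<open>c\<close>, one is at
  least the root of the squared distance to their midpoint plus \<open>\<eta>\<^sup>2\<close>. Hence
  \<open>f\<close> lies below a profile of that root, and \<open>shrink_gain\<close> trades the root
  for a smaller matrix and a smaller exponent; the cost changes by the factor
  \<open>exp (- g) / k ^ CARD('n)\<close>.\<close>

lemma covers_distinct_centers_improve:
  fixes A :: "real^'n^'n"
  assumes "covers f A b \<beta>" "covers f A c \<beta>" "b \<noteq> c" and A: "invertible A"
  obtains A' b' \<beta>' where "invertible A'" "covers f A' b' \<beta>'" "cost A' \<beta>' < cost A \<beta>"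
proof -
  define \<eta> where "\<eta> = norm (b - c) / 2"
  have "\<eta> > 0" using assms(3) by (simp add: \<eta>_def)
  from shrink_gain[OF this, of "CARD('n)"] obtain k g where k: "k > 0" and g: "exp (- g) < k ^ CARD('n)"
    and gain: "\<And>r. r \<ge> 0 \<Longrightarrow> h (k * r) + g \<le> h (sqrt (r\<^sup>2 + \<eta>\<^sup>2))"
    by blast
  let ?m = "(1/2) *\<^sub>R (b + c)"
  have det: "det (k *\<^sub>R A) = k ^ CARD('n) * det A"
  proof -
    have "k *\<^sub>R A = mat k ** A"
      by (simp add: vec_eq_iff matrix_matrix_mult_def mat_def if_distrib[of "\<lambda>z. z * _"] cong: if_cong)
    thus ?thesis by (simp add: det_mul matrix_scaleR[symmetric])
  qed
  show ?thesis
  proof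
    show "invertible (k *\<^sub>R A)" using A k by (simp add: invertible_det_nz det)
    show "covers f (k *\<^sub>R A) (k *\<^sub>R ?m) (\<beta> - g)"
      unfolding covers_def
    proof
      fix x
      let ?y = "A *v x - ?m" and ?z = "(1/2) *\<^sub>R (b - c)"
      have aux: "P \<le> Q \<or> P \<le> R" if "Q + R = 2 * P" for P Q R :: real using that by auto
      have yb: "A *v x - b = ?y - ?z" and yc: "A *v x - c = ?y + ?z"
        by (simp_all add: algebra_simps scaleR_left_distrib[symmetric])
      have "(norm (?y - ?z))\<^sup>2 + (norm (?y + ?z))\<^sup>2 = 2 * ((norm ?y)\<^sup>2 + (norm ?z)\<^sup>2)"
        unfolding power2_norm_eq_inner by (simp only: inner_simps) (simp add: inner_commute algebra_simps)
      moreover have "norm ?z = \<eta>" by (simp add: \<eta>_def)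
      ultimately have "(norm (?y - ?z))\<^sup>2 + (norm (?y + ?z))\<^sup>2 = 2 * ((norm ?y)\<^sup>2 + \<eta>\<^sup>2)" by metis
      hence "(norm ?y)\<^sup>2 + \<eta>\<^sup>2 \<le> (norm (A *v x - b))\<^sup>2 \<or> (norm ?y)\<^sup>2 + \<eta>\<^sup>2 \<le> (norm (A *v x - c))\<^sup>2"
        unfolding yb yc by (rule aux)
      then obtain a where a: "a = b \<or> a = c" and "(norm ?y)\<^sup>2 + \<eta>\<^sup>2 \<le> (norm (A *v x - a))\<^sup>2" by blast
      hence "sqrt ((norm ?y)\<^sup>2 + \<eta>\<^sup>2) \<le> norm (A *v x - a)" by (intro real_le_lsqrt) auto
      hence "h (sqrt ((norm ?y)\<^sup>2 + \<eta>\<^sup>2)) \<le> h (norm (A *v x - a))" by (intro mono) auto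
      with gain[of "norm ?y"] have "h (k * norm ?y) + g \<le> h (norm (A *v x - a))" by simp
      moreover have "(k *\<^sub>R A) *v x - k *\<^sub>R ?m = k *\<^sub>R ?y"
        by (simp only: scaleR_matrix_vector_assoc[symmetric] scaleR_diff_right)
      moreover have "f x \<le> exp (\<beta> - h (norm (A *v x - a)))"
        using assms(1,2) a by (auto simp: covers_def)
      ultimately have "f x \<le> exp (\<beta> - h (norm (A *v x - a)))"
        "exp (\<beta> - h (norm (A *v x - a))) \<le> exp (\<beta> - g - h (norm ((k *\<^sub>R A) *v x - k *\<^sub>R ?m)))"
        using k by (auto simp only: norm_scaleR abs_of_pos exp_le_cancel_iff)
      thus "f x \<le> exp (\<beta> - g - h (norm ((k *\<^sub>R A) *v x - k *\<^sub>R ?m)))" by (rule order_trans)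
    qed
    have "cost (k *\<^sub>R A) (\<beta> - g) = (exp (- g) / k ^ CARD('n)) * cost A \<beta>"
      using k by (simp add: cost_def det abs_mult exp_diff exp_minus field_simps)
    also have "\<dots> < 1 * cost A \<beta>"
      using g k A by (intro mult_strict_right_mono) (auto simp: cost_def invertible_det_nz)
    finally show "cost (k *\<^sub>R A) (\<beta> - g) < cost A \<beta>" by simp
  qed
qed

lemma minimal_cover_unique:
  fixes A B :: "real^'n^'n"
  assumes A: "invertible A" "covers f A b \<beta>" and B: "invertible B" "covers f B c \<gamma>"
    and minimal: "\<And>A' b' \<beta>'. invertible A' \<Longrightarrow> covers f A' b' \<beta>' \<Longrightarrow> cost A \<beta> \<le> cost A' \<beta>'"
    and eq: "cost B \<gamma> = cost A \<beta>"
  shows "\<beta> - h (norm (A *v x - b)) = \<gamma> - h (norm (B *v x - c))"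
proof -
  obtain U where U: "orthogonal_matrix U" and inv: "invertible ((1/2) *\<^sub>R (A + U ** B))"
    and UB: "(det ((1/2) *\<^sub>R (A + U ** B)))\<^sup>2 \<le> \<bar>det A\<bar> * \<bar>det B\<bar> \<longrightarrow> U ** B = A"
    using det_rotated_midpoint[OF A(1) B(1)] by blast
  let ?M = "(1/2) *\<^sub>R (A + U ** B)"
  have cov: "covers f (U ** B) (U *v c) \<gamma>" using covers_orthogonal[OF U] B(2) by blast
  have d: "\<bar>det A\<bar> > 0" "\<bar>det B\<bar> > 0" "\<bar>det ?M\<bar> > 0"
    using A(1) B(1) inv by (auto simp only: invertible_det_nz zero_less_abs_iff)
  have "cost A \<beta> \<le> cost ?M ((\<beta> + \<gamma>) / 2)" by (rule minimal[OF inv covers_midpoint[OF A(2) cov]])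
  hence "(cost A \<beta>)\<^sup>2 \<le> (cost ?M ((\<beta> + \<gamma>) / 2))\<^sup>2"
    by (intro power_mono) (auto simp: cost_def)
  \<comment> \<open>The product of the two equal costs carries the same exponential as the squared
    midpoint cost; cancelling it leaves the determinant inequality that forces
    \<open>U ** B = A\<close>.\<close>
  hence "cost A \<beta> * cost B \<gamma> \<le> (cost ?M ((\<beta> + \<gamma>) / 2))\<^sup>2" by (simp add: eq power2_eq_square)
  also have "\<dots> = exp (\<beta> + \<gamma>) / (det ?M)\<^sup>2"
    by (simp add: cost_def power_divide exp_double[symmetric])
  finally have "exp (\<beta> + \<gamma>) / (\<bar>det A\<bar> * \<bar>det B\<bar>) \<le> exp (\<beta> + \<gamma>) / (det ?M)\<^sup>2"
    by (simp add: cost_def exp_add)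
  moreover have "(det ?M)\<^sup>2 > 0" "\<bar>det A\<bar> * \<bar>det B\<bar> > 0" using d by auto
  ultimately have "(det ?M)\<^sup>2 \<le> \<bar>det A\<bar> * \<bar>det B\<bar>" by (simp add: frac_le_eq divide_simps)
  hence UBA: "U ** B = A" using UB by blast
  have "\<bar>det A\<bar> = \<bar>det B\<bar>" unfolding UBA[symmetric] using U by (simp add: det_mul abs_mult abs_det_orthogonal)
  hence \<gamma>: "\<gamma> = \<beta>" using eq d by (simp add: cost_def)
  have "U *v c = b"
  proof (rule ccontr)
    assume "U *v c \<noteq> b"
    hence "b \<noteq> U *v c" by simp
    from covers_distinct_centers_improve[OF A(2) _ this A(1)] cov
    obtain A' b' \<beta>' where "invertible A'" "covers f A' b' \<beta>'" "cost A' \<beta>' < cost A \<beta>"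
      unfolding UBA \<gamma> by blast
    thus False using minimal by force
  qed
  hence "norm (A *v x - b) = norm (U *v (B *v x - c))"
    unfolding UBA[symmetric] by (simp add: matrix_vector_mul_assoc matrix_vector_mult_diff_distrib)
  thus ?thesis by (simp add: \<gamma> norm_orthogonal_matrix[OF U])
qed

end

subsection \<open>Exponential decay of log-concave functions\<close>

lemma upper_semicontinuous_borel_measurable:
  fixes f :: "'a::topological_space \<Rightarrow> real"
  assumes "upper_semicontinuous f"
  shows "f \<in> borel_measurable borel"
proof -
  have "open {x. f x < c}" for c
    unfolding open_subopen[of "{x. f x < c}"]
    using assms by (fastforce simp: upper_semicontinuous_def eventually_nhds)
  thus ?thesis by (auto simp: borel_measurable_iff_less)
qed

lemma log_concave_fun_nonneg: "log_concave_fun f \<Longrightarrow> f x \<ge> 0"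
  by (auto simp: log_concave_fun_def)

text \<open>Where \<open>f\<close> is positive, \<open>\<phi>\<close> is finite, and the extended
  convexity inequality becomes one between reals.\<close>

lemma log_concave_fun_powr:
  assumes f: "log_concave_fun f" and pos: "f x > 0" "f y > 0" and uv: "u > 0" "v > 0" "u + v = 1"
  shows "f x powr u * f y powr v \<le> f (u *\<^sub>R x + v *\<^sub>R y)"
proof -
  obtain \<phi> where \<phi>: "convex_ext \<phi>"
    and f: "\<And>x. f x = (if \<phi> x = \<infinity> then 0 else exp (- real_of_ereal (\<phi> x)))"
    using f by (auto simp: log_concave_fun_def)
  have fin: "\<phi> z \<noteq> - \<infinity>" for z using \<phi> by (auto simp: convex_ext_def)
  obtain a b where a: "\<phi> x = ereal a" and b: "\<phi> y = ereal b"
    using pos fin[of x] fin[of y] by (cases "\<phi> x"; cases "\<phi> y") (auto simp: f)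
  have "\<phi> (u *\<^sub>R x + v *\<^sub>R y) \<le> ereal u * \<phi> x + ereal v * \<phi> y"
    using \<phi> uv by (auto simp: convex_ext_def)
  then obtain c where "\<phi> (u *\<^sub>R x + v *\<^sub>R y) = ereal c" "c \<le> u * a + v * b"
    using fin[of "u *\<^sub>R x + v *\<^sub>R y"] by (cases "\<phi> (u *\<^sub>R x + v *\<^sub>R y)") (auto simp: a b)
  thus ?thesis by (simp add: f a b powr_def exp_add[symmetric])
qed

lemma convex_superlevel:
  assumes f: "log_concave_fun f" and e: "e > 0"
  shows "convex {x. e \<le> f x}"
  unfolding convex_alt
proof (intro ballI allI impI)
  fix x y and u :: real
  assume xy: "x \<in> {x. e \<le> f x}" "y \<in> {x. e \<le> f x}" and u: "0 \<le> u \<and> u \<le> 1"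
  show "(1 - u) *\<^sub>R x + u *\<^sub>R y \<in> {x. e \<le> f x}"
  proof (cases "u = 0 \<or> u = 1")
    case False
    have "e = e powr (1 - u) * e powr u" using e by (simp add: powr_add[symmetric])
    also have "\<dots> \<le> f x powr (1 - u) * f y powr u"
      using xy u e by (intro mult_mono powr_mono2) auto
    also have "\<dots> \<le> f ((1 - u) *\<^sub>R x + u *\<^sub>R y)"
      using xy u e False by (intro log_concave_fun_powr[OF f]) auto
    finally show ?thesis by simp
  qed (use xy in auto)
qed

lemma level_emeasure_le_nn_integral:
  assumes "S \<in> sets borel" "\<And>x. x \<in> S \<Longrightarrow> a \<le> f x"
  shows "ennreal a * emeasure lborel S \<le> (\<integral>\<^sup>+x. ennreal (f x) \<partial>lborel)"
proof -
  have "ennreal a * emeasure lborel S = (\<integral>\<^sup>+x. ennreal a * indicator S x \<partial>lborel)"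
    using assms(1) by (simp add: nn_integral_cmult_indicator)
  also have "\<dots> \<le> (\<integral>\<^sup>+x. ennreal (f x) \<partial>lborel)"
    using assms(2) by (intro nn_integral_mono) (auto simp: indicator_def intro: ennreal_leI)
  finally show ?thesis .
qed

text \<open>Otherwise the sets where \<open>f\<close> is at least 1 / (n + 1) would all be convex
  with empty interior, hence null; they exhaust the support, so the integral would vanish.\<close>

lemma log_concave_ball_superlevel:
  fixes f :: "'a::euclidean_space \<Rightarrow> real"
  assumes f: "log_concave_fun f" and [measurable]: "f \<in> borel_measurable borel"
    and pos: "0 < (\<integral>\<^sup>+x. ennreal (f x) \<partial>lborel)"
  obtains x0 r e where "r > 0" "e > 0" "\<And>y. y \<in> ball x0 r \<Longrightarrow> e \<le> f y"
proof -
  let ?K = "\<lambda>n::nat. {x. inverse (real (Suc n)) \<le> f x}"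
  have "\<exists>n. interior (?K n) \<noteq> {}"
  proof (rule ccontr)
    assume "\<nexists>n. interior (?K n) \<noteq> {}"
    hence "negligible (?K n)" for n
      using negligible_convex_interior[OF convex_superlevel[OF f]] by simp
    hence "?K n \<in> null_sets lborel" for n
      by (simp add: negligible_iff_null_sets null_sets_completion_iff)
    hence "(\<Union>n. ?K n) \<in> null_sets lborel" by (rule null_sets_UN)
    moreover have "{x. f x \<noteq> 0} \<subseteq> (\<Union>n. ?K n)"
    proof
      fix x assume "x \<in> {x. f x \<noteq> 0}"
      hence "f x > 0" using log_concave_fun_nonneg[OF f, of x] by simp
      then obtain n where "inverse (real (Suc n)) < f x" using reals_Archimedean by blast
      thus "x \<in> (\<Union>n. ?K n)" by (auto intro: less_imp_le)
    qed
    ultimately have "AE x in lborel. f x = 0"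
      by (intro AE_I'[of "\<Union>n. ?K n"]) auto
    hence "(\<integral>\<^sup>+x. ennreal (f x) \<partial>lborel) = 0"
      by (subst nn_integral_0_iff_AE) auto
    thus False using pos by simp
  qed
  then obtain n x0 where "x0 \<in> interior (?K n)" by blast
  then obtain r where "r > 0" "ball x0 r \<subseteq> ?K n" by (auto simp: mem_interior)
  thus ?thesis by (intro that[of r "inverse (real (Suc n))" x0]) auto
qed

text \<open>Log-concavity between \<open>x\<close> and the points of the given ball keeps
  \<open>f\<close> above \<open>sqrt (f x * e)\<close> on the ball of radius \<open>r / 2\<close>
  around the midpoint of \<open>x0\<close> and \<open>x\<close>. The volume of that ball does not
  depend on \<open>x\<close>, so the integral bounds \<open>f x\<close>.\<close>

lemma log_concave_bounded:
  fixes f :: "'a::euclidean_space \<Rightarrow> real"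
  assumes f: "log_concave_fun f" and fin: "(\<integral>\<^sup>+x. ennreal (f x) \<partial>lborel) < \<infinity>"
    and r: "r > 0" and e: "e > 0" and ball: "\<And>y. y \<in> ball x0 r \<Longrightarrow> e \<le> f y"
  obtains C where "\<And>x. f x \<le> C"
proof -
  obtain I where I: "(\<integral>\<^sup>+x. ennreal (f x) \<partial>lborel) = ennreal I" "I \<ge> 0"
    using fin by (cases "\<integral>\<^sup>+x. ennreal (f x) \<partial>lborel") auto
  define V where "V = unit_ball_vol (DIM('a)) * (r / 2) ^ DIM('a)"
  have V: "V > 0" using r by (simp add: V_def)
  have emV: "emeasure lborel (ball c (r / 2)) = ennreal V" for c :: 'a
    using r by (simp add: V_def emeasure_ball)
  have "f x \<le> (I / V)\<^sup>2 / e" if fx: "f x > 0" for x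
  proof -
    have "sqrt (f x * e) \<le> f y" if y: "y \<in> ball ((1/2) *\<^sub>R (x0 + x)) (r / 2)" for y
    proof -
      let ?z = "2 *\<^sub>R y - x"
      have "x0 - ?z = 2 *\<^sub>R ((1/2) *\<^sub>R (x0 + x) - y)" by (simp add: algebra_simps)
      hence "norm (x0 - ?z) = 2 * norm ((1/2) *\<^sub>R (x0 + x) - y)" by simp
      hence "?z \<in> ball x0 r" using y by (simp add: dist_norm)
      hence z: "e \<le> f ?z" by (rule ball)
      have "sqrt (f x * e) = f x powr (1/2) * e powr (1/2)"
        using fx e by (simp add: powr_half_sqrt real_sqrt_mult)
      also have "\<dots> \<le> f x powr (1/2) * f ?z powr (1/2)"
        using z e by (intro mult_left_mono powr_mono2) auto
      also have "\<dots> \<le> f ((1/2) *\<^sub>R x + (1/2) *\<^sub>R ?z)"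
        using z e fx by (intro log_concave_fun_powr[OF f]) auto
      also have "(1/2) *\<^sub>R x + (1/2) *\<^sub>R ?z = y" by (simp add: algebra_simps)
      finally show ?thesis .
    qed
    from level_emeasure_le_nn_integral[of "ball ((1/2) *\<^sub>R (x0 + x)) (r / 2)" "sqrt (f x * e)" f, OF _ this]
    have "ennreal (sqrt (f x * e)) * ennreal V \<le> ennreal I"
      by (simp add: emV I)
    hence "sqrt (f x * e) * V \<le> I"
      using fx e V I by (simp add: ennreal_mult'[symmetric])
    hence "sqrt (f x * e) \<le> I / V" using V by (simp add: field_simps)
    hence "(sqrt (f x * e))\<^sup>2 \<le> (I / V)\<^sup>2" using fx e by (intro power_mono) auto
    thus ?thesis using fx e by (simp add: pos_le_divide_eq)
  qed
  moreover have "(I / V)\<^sup>2 / e \<ge> 0" using e by simp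
  ultimately have "f x \<le> (I / V)\<^sup>2 / e" for x by (cases "f x > 0") force+
  thus ?thesis by (rule that)
qed

text \<open>A convex set containing \<open>ball x0 r\<close> and a point \<open>x\<close> contains about \<open>norm (x - x0) / (2 * r)\<close>
  disjoint balls of radius \<open>r / 2\<close>, so a set of finite measure cannot reach far.\<close>

lemma convex_finite_measure_bounded:
  fixes K :: "'a::euclidean_space set"
  assumes K: "convex K" "K \<in> sets borel" and fin: "emeasure lborel K < \<infinity>"
    and r: "r > 0" and ball: "ball x0 r \<subseteq> K"
  obtains L where "L > 0" "\<And>x. x \<in> K \<Longrightarrow> norm (x - x0) < L"
proof -
  obtain I where I: "emeasure lborel K = ennreal I" "I \<ge> 0"
    using fin by (cases "emeasure lborel K") auto
  define V where "V = unit_ball_vol (DIM('a)) * (r / 2) ^ DIM('a)"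
  have V: "V > 0" using r by (simp add: V_def)
  have emV: "emeasure lborel (ball c (r / 2)) = ennreal V" for c :: 'a
    using r by (simp add: V_def emeasure_ball)
  obtain N where N: "I / V < real N" using reals_Archimedean2 by blast
  have N0: "N > 0" using N I V by (cases N) (auto simp: field_simps)
  show ?thesis
  proof
    show "2 * N * r > 0" using N0 r by simp
    fix x assume x: "x \<in> K"
    show "norm (x - x0) < 2 * N * r"
    proof (rule ccontr)
      let ?n = "norm (x - x0)"
      assume "\<not> ?n < 2 * N * r"
      hence far: "2 * N * r \<le> ?n" by simp
      have "2 * N * r > 0" using N0 r by simp
      hence n0: "?n > 0" using far by linarith
      \<comment> \<open>Centers at spacing \<open>r\<close> from \<open>x0\<close> towards
        \<open>x\<close>. For \<open>k < N\<close> they stay in the first half of the segment, so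
        contracting \<open>ball x0 r\<close> towards \<open>x\<close> by the factor
        \<open>1 - t k\<close> leaves a radius of at least \<open>r / 2\<close>.\<close>
      define t where "t k = real k * r / ?n" for k
      define c where "c k = x0 + t k *\<^sub>R (x - x0)" for k
      let ?B = "\<lambda>k. ball (c k) (r / 2)"
      have t: "0 \<le> t k" "t k \<le> 1/2" if "k < N" for k
      proof -
        have "2 * real k * r \<le> 2 * N * r" using that r by simp
        hence "2 * real k * r \<le> ?n" using far by linarith
        thus "0 \<le> t k" "t k \<le> 1/2" using n0 r by (simp_all add: t_def pos_divide_le_eq)
      qed
      have sub: "?B k \<subseteq> K" if k: "k < N" for k
      proof
        fix y assume y: "y \<in> ?B k"
        define z where "z = x0 + (1 / (1 - t k)) *\<^sub>R (y - c k)"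
        have t1: "1 - t k \<ge> 1/2" using t[OF k] by simp
        have "norm (z - x0) = norm (y - c k) / (1 - t k)" using t1 by (simp add: z_def)
        also have "\<dots> \<le> norm (y - c k) / (1/2)" using t1 by (intro divide_left_mono) auto
        also have "\<dots> < r" using y by (simp add: dist_norm norm_minus_commute)
        finally have "z \<in> K" using ball by (auto simp: dist_norm norm_minus_commute)
        hence "(1 - t k) *\<^sub>R z + t k *\<^sub>R x \<in> K" using K(1) x t[OF k] by (auto simp: convex_alt)
        also have "(1 - t k) *\<^sub>R z + t k *\<^sub>R x = y"
          using t1 by (simp add: z_def c_def scaleR_add_right) (simp add: algebra_simps)
        finally show "y \<in> K" .
      qed
      have disj: "disjoint_family_on ?B {..<N}"
      proof -
        have "?B i \<inter> ?B j = {}" if "i \<noteq> j" for i j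
        proof -
          have "c i - c j = (t i - t j) *\<^sub>R (x - x0)" by (simp add: c_def algebra_simps)
          moreover have "t i - t j = (real i - real j) * r / ?n" by (simp add: t_def diff_divide_distrib left_diff_distrib)
          ultimately have "dist (c i) (c j) = \<bar>real i - real j\<bar> * r"
            using n0 r by (simp add: dist_norm abs_mult)
          also have "\<dots> \<ge> 1 * r" using that r by (intro mult_right_mono) auto
          finally show ?thesis by (intro disjoint_ballI) simp
        qed
        thus ?thesis by (simp add: disjoint_family_on_def)
      qed
      have "ennreal (N * V) = (\<Sum>k<N. emeasure lborel (?B k))"
        using V by (simp add: emV ennreal_of_nat_eq_real_of_nat ennreal_mult')
      also have "\<dots> = emeasure lborel (\<Union>k<N. ?B k)"
        using disj by (intro sum_emeasure) auto
      also have "\<dots> \<le> emeasure lborel K" using sub K(2) by (intro emeasure_mono) auto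
      finally have "N * V \<le> I" using I V by simp
      thus False using N V by (simp add: field_simps)
    qed
  qed
qed

text \<open>At distance \<open>L\<close> the logarithm of \<open>f\<close> has dropped below
  \<open>ln e - 1\<close>, while it is at least \<open>ln e\<close> at \<open>x0\<close>; by
  concavity it keeps falling by at least one per length \<open>L\<close>. Inside that radius the
  upper bound \<open>M\<close> works once multiplied by \<open>exp 1\<close>.\<close>

lemma log_concave_exponential_decay:
  fixes f :: "'a::euclidean_space \<Rightarrow> real"
  assumes f: "log_concave_fun f" and [measurable]: "f \<in> borel_measurable borel"
    and fin: "(\<integral>\<^sup>+x. ennreal (f x) \<partial>lborel) < \<infinity>"
    and r: "r > 0" and e: "e > 0" and ball: "\<And>y. y \<in> ball x0 r \<Longrightarrow> e \<le> f y"
  obtains c C where "c > 0" "C > 0" "\<And>x. f x \<le> C * exp (- c * norm (x - x0))"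
proof -
  obtain M where M: "\<And>x. f x \<le> M" using log_concave_bounded[OF f fin r e ball] by blast
  have fx0: "f x0 \<ge> e" using ball r by simp
  hence Me: "M \<ge> e" using M[of x0] by simp
  define K where "K = {x. e * exp (- 1) \<le> f x}"
  have ee: "e * exp (- 1) > 0" using e by simp
  have Kb: "K \<in> sets borel" unfolding K_def by measurable
  have "ennreal (e * exp (- 1)) * emeasure lborel K < \<infinity>"
    using level_emeasure_le_nn_integral[OF Kb, of "e * exp (- 1)" f] fin by (auto simp: K_def)
  hence emK: "emeasure lborel K < \<infinity>" using ee by (auto simp: ennreal_mult_less_top less_top)
  have "e * exp (- 1) \<le> e * 1" using e by (intro mult_left_mono) auto
  hence bK: "ball x0 r \<subseteq> K" using ball by (force simp: K_def)
  have "convex K" unfolding K_def by (rule convex_superlevel[OF f ee])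
  then obtain L where L: "L > 0" "\<And>x. x \<in> K \<Longrightarrow> norm (x - x0) < L"
    using convex_finite_measure_bounded[OF _ Kb emK r bK] by blast
  show ?thesis
  proof (rule that[of "1 / L" "M * exp 1"])
    fix x
    show "f x \<le> M * exp 1 * exp (- (1 / L) * norm (x - x0))"
    proof (cases "norm (x - x0) \<le> L")
      case True
      hence "norm (x - x0) / L \<le> 1" using L by simp
      have "f x \<le> M * 1" using M by simp
      also have "\<dots> \<le> M * exp (1 - norm (x - x0) / L)"
        using Me e \<open>norm (x - x0) / L \<le> 1\<close> by (intro mult_left_mono) auto
      also have "exp (1 - norm (x - x0) / L) = exp 1 * exp (- (1 / L) * norm (x - x0))"
        by (simp add: exp_add[symmetric])
      finally show ?thesis by (simp only: mult.assoc)
    next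
      case False
      show ?thesis
      proof (cases "f x > 0")
        case True
        \<comment> \<open>Puts \<open>?y\<close> at distance exactly \<open>L\<close> from
          \<open>x0\<close>; the strict bound on \<open>K\<close> therefore excludes it from
          \<open>K\<close>.\<close>
        define t where "t = L / norm (x - x0)"
        have n0: "norm (x - x0) > 0" using L \<open>\<not> norm (x - x0) \<le> L\<close> by linarith
        have t: "0 < t" unfolding t_def using L(1) n0 by (rule divide_pos_pos)
        have t1: "t < 1" unfolding t_def pos_divide_less_eq[OF n0] using \<open>\<not> norm (x - x0) \<le> L\<close> by simp
        let ?y = "(1 - t) *\<^sub>R x0 + t *\<^sub>R x"
        have "?y - x0 = t *\<^sub>R (x - x0)" by (simp add: algebra_simps)
        hence "norm (?y - x0) = t * norm (x - x0)" using t by simp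
        also have "\<dots> = L" using n0 by (simp add: t_def)
        finally have "?y \<notin> K" using L(2)[of ?y] by auto
        hence "f ?y < e * exp (- 1)" by (simp add: K_def)
        moreover have "f x0 powr (1 - t) * f x powr t \<le> f ?y"
          using fx0 e True t t1 by (intro log_concave_fun_powr[OF f]) auto
        moreover have "e powr (1 - t) * f x powr t \<le> f x0 powr (1 - t) * f x powr t"
          using fx0 e t t1 by (intro mult_right_mono powr_mono2) auto
        ultimately have "e powr (1 - t) * f x powr t < e * exp (- 1)" by linarith
        moreover have "e powr (1 - t) * f x powr t = exp ((1 - t) * ln e + t * ln (f x))"
          using e True by (simp add: powr_def exp_add)
        moreover have "e * exp (- 1) = exp (ln e - 1)"
          using e exp_add[of "ln e" "- 1"] by simp
        ultimately have "exp ((1 - t) * ln e + t * ln (f x)) < exp (ln e - 1)" by simp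
        hence "t * (ln (f x) - ln e) < - 1" by (simp add: algebra_simps)
        hence "ln (f x) - ln e < - 1 / t" using t by (simp only: pos_less_divide_eq mult.commute)
        hence "ln (f x) \<le> ln e - norm (x - x0) / L" by (simp add: t_def)
        hence "exp (ln (f x)) \<le> exp (ln e - norm (x - x0) / L)" by simp
        also have "\<dots> = e * exp (- (1 / L) * norm (x - x0))"
          using e exp_add[of "ln e" "- (1 / L) * norm (x - x0)"] by simp
        finally have "f x \<le> e * exp (- (1 / L) * norm (x - x0))" using True by simp
        also have "\<dots> \<le> (M * exp 1) * exp (- (1 / L) * norm (x - x0))"
        proof (rule mult_right_mono)
          have "M * 1 \<le> M * exp 1" using Me e by (intro mult_left_mono) auto
          thus "e \<le> M * exp 1" using Me by simp
        qed simp
        finally show ?thesis .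
      next
        case False
        have "0 \<le> M * exp 1 * exp (- (1 / L) * norm (x - x0))" using Me e by simp
        thus ?thesis using False by linarith
      qed
    qed
  qed (use L Me e in auto)
qed

subsection \<open>Existence\<close>

text \<open>Crude entrywise bounds suffice: against an exponential only the order
  \<open>S ^ CARD('n)\<close> of the determinant matters.\<close>

lemma matrix_norm_bounds_of_columns:
  fixes A :: "real^'n^'n"
  assumes S: "\<And>j. norm (column j A) \<le> S"
  shows "\<bar>det A\<bar> \<le> fact CARD('n) * S ^ CARD('n)"
    and "norm A \<le> (real CARD('n))\<^sup>2 * S"
    and "norm (A *v x) \<le> (\<Sum>j\<in>UNIV. \<bar>x $ j\<bar>) * S"
proof -
  have ij: "\<bar>A $ i $ j\<bar> \<le> S" for i j
    using component_le_norm_cart[of "column j A" i] S[of j] by (simp add: column_def)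
  have "\<bar>det A\<bar> \<le> (\<Sum>p | p permutes (UNIV::'n set). \<bar>of_int (sign p) * (\<Prod>i\<in>UNIV. A $ i $ p i)\<bar>)"
    unfolding det_def by (rule sum_abs)
  also have "\<dots> \<le> (\<Sum>p | p permutes (UNIV::'n set). S ^ CARD('n))"
  proof (rule sum_mono)
    fix p :: "'n \<Rightarrow> 'n"
    have "\<bar>of_int (sign p) * (\<Prod>i\<in>UNIV. A $ i $ p i)\<bar> = (\<Prod>i\<in>UNIV. \<bar>A $ i $ p i\<bar>)"
      by (simp add: abs_mult sign_def abs_prod)
    also have "\<dots> \<le> (\<Prod>i\<in>(UNIV::'n set). S)" using ij by (intro prod_mono) auto
    finally show "\<bar>of_int (sign p) * (\<Prod>i\<in>UNIV. A $ i $ p i)\<bar> \<le> S ^ CARD('n)" by simp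
  qed
  also have "\<dots> = fact CARD('n) * S ^ CARD('n)" by (simp add: card_permutations)
  finally show "\<bar>det A\<bar> \<le> fact CARD('n) * S ^ CARD('n)" .
  have "norm A \<le> (\<Sum>i\<in>UNIV. norm (A $ i))"
    unfolding norm_vec_def by (rule L2_set_le_sum) simp
  also have "\<dots> \<le> (\<Sum>i\<in>(UNIV::'n set). \<Sum>j\<in>(UNIV::'n set). S)"
    using ij by (intro sum_mono order_trans[OF norm_le_l1_cart]) auto
  finally show "norm A \<le> (real CARD('n))\<^sup>2 * S" by (simp add: power2_eq_square mult_ac)
  have "norm (A *v x) = norm (\<Sum>j\<in>UNIV. x $ j *s column j A)" by (simp add: matrix_mult_sum)
  also have "\<dots> \<le> (\<Sum>j\<in>UNIV. norm (x $ j *s column j A))" by (rule norm_sum)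
  also have "\<dots> \<le> (\<Sum>j\<in>UNIV. \<bar>x $ j\<bar> * S)"
    using S by (intro sum_mono) (simp add: scalar_mult_eq_scaleR mult_left_mono)
  finally show "norm (A *v x) \<le> (\<Sum>j\<in>UNIV. \<bar>x $ j\<bar>) * S" by (simp add: sum_distrib_right)
qed

lemma exp_le_power_imp_bounded:
  fixes W :: real
  obtains X where "\<And>x. exp x \<le> W * x ^ n \<Longrightarrow> x \<le> X"
proof -
  have "eventually (\<lambda>x::real. x ^ n / exp x < 1 / (\<bar>W\<bar> + 1)) at_top"
    by (rule order_tendstoD(2)[OF tendsto_power_div_exp_0]) simp
  then obtain X0 where X0: "\<And>x::real. x \<ge> X0 \<Longrightarrow> x ^ n / exp x < 1 / (\<bar>W\<bar> + 1)"
    by (auto simp: eventually_at_top_linorder)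
  show ?thesis
  proof (rule that[of "max X0 0"], rule ccontr)
    fix x assume le: "exp x \<le> W * x ^ n" and "\<not> x \<le> max X0 0"
    hence x: "x > 0" "x \<ge> X0" by auto
    have "x ^ n * (\<bar>W\<bar> + 1) < exp x" using X0[OF x(2)] by (simp add: field_simps)
    moreover have "W * x ^ n \<le> (\<bar>W\<bar> + 1) * x ^ n" using x by (intro mult_right_mono) auto
    ultimately show False using le by (simp add: mult.commute)
  qed
qed

section \<open>Compactness of the set of affordable covers\<close>

context convex_profile
begin

text \<open>\<open>R\<close> is the radius that \<open>linear_lower_bound\<close> allows for
  \<open>A *v y - b\<close> on the ball, where \<open>f\<close> is at least \<open>e\<close>. Two
  points of the ball at distance \<open>r / 2\<close> along an axis then bound a column by
  \<open>2 * R\<close> over \<open>r / 2\<close>.\<close>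

lemma cover_parameter_bounds:
  fixes f :: "real^'n \<Rightarrow> real"
  assumes r: "r > 0" and e: "e > 0" and ball: "\<And>y. y \<in> ball x0 r \<Longrightarrow> e \<le> f y"
    and cov: "covers f (A :: real^'n^'n) b \<beta>"
  defines "R \<equiv> (\<beta> - ln e + h 1) / h 1"
  shows "ln e \<le> \<beta>" "norm (A *v x0 - b) \<le> R" "norm (column j A) \<le> 4 / r * R"
proof -
  have h1: "h 1 > 0" by (rule pos) simp
  have key: "h (norm (A *v y - b)) \<le> \<beta> - ln e" if "y \<in> ball x0 r" for y
  proof -
    have "exp (ln e) \<le> exp (\<beta> - h (norm (A *v y - b)))"
      using ball[OF that] cov e by (simp add: covers_def order_trans)
    thus ?thesis by simp
  qed
  have R: "norm (A *v y - b) \<le> R" if "y \<in> ball x0 r" for y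
  proof -
    have "h 1 * norm (A *v y - b) - h 1 \<le> \<beta> - ln e"
      using key[OF that] linear_lower_bound[of "norm (A *v y - b)"] by simp
    thus ?thesis using h1 by (simp add: R_def pos_le_divide_eq mult.commute)
  qed
  have x0: "x0 \<in> ball x0 r" using r by simp
  show "ln e \<le> \<beta>" using key[OF x0] nonneg[of "norm (A *v x0 - b)"] by simp
  show "norm (A *v x0 - b) \<le> R" by (rule R[OF x0])
  let ?y = "x0 + (r / 2) *\<^sub>R axis j 1"
  have "norm (A *v ?y - b) \<le> R" using r by (intro R) (simp add: dist_norm)
  moreover have "A *v ?y - b - (A *v x0 - b) = (r / 2) *\<^sub>R column j A"
    by (simp add: matrix_vector_right_distrib matrix_vector_mult_scaleR matrix_vector_mult_basis)
  hence "norm ((r / 2) *\<^sub>R column j A) \<le> norm (A *v ?y - b) + norm (A *v x0 - b)"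
    by (metis norm_triangle_ineq4)
  ultimately have "r / 2 * norm (column j A) \<le> 2 * R" using R[OF x0] r by simp
  thus "norm (column j A) \<le> 4 / r * R" using r by (simp add: field_simps)
qed

text \<open>With x = \<open>\<beta> - ln e + h 1\<close> the columns of \<open>A\<close> are of
  order x, so the cost bound becomes \<open>exp x \<le> W * x ^ CARD('n)\<close>. This bounds x and
  with it all parameters, as \<open>ln e \<le> \<beta>\<close>. The factor
  \<open>exp (h 1) / e\<close> in \<open>W\<close> converts \<open>exp \<beta>\<close> into
  \<open>exp x\<close>.\<close>

lemma bounded_covers:
  fixes f :: "real^'n \<Rightarrow> real"
  assumes r: "r > 0" and e: "e > 0" and ball: "\<And>y. y \<in> ball x0 r \<Longrightarrow> e \<le> f y"
  shows "bounded {(A, b, \<beta>). covers f A b \<beta> \<and> exp \<beta> \<le> V * \<bar>det A\<bar>}"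
proof -
  have h1: "h 1 > 0" by (rule pos) simp
  let ?n = "CARD('n)"
  define W where "W = exp (h 1) / e * (\<bar>V\<bar> * fact ?n * (4 / r / h 1) ^ ?n)"
  obtain X where X: "\<And>x. exp x \<le> W * x ^ ?n \<Longrightarrow> x \<le> X" using exp_le_power_imp_bounded[of W "CARD('n)"] by blast
  define S where "S = 4 / r * (X / h 1)"
  define B where "B = (real ?n)\<^sup>2 * S + (((\<Sum>j\<in>UNIV. \<bar>x0 $ j\<bar>) * S + X / h 1) + (\<bar>X\<bar> + \<bar>ln e\<bar> + h 1))"
  have "norm (A, b, \<beta>) \<le> B" if cov: "covers f A b \<beta>" and V: "exp \<beta> \<le> V * \<bar>det A\<bar>" for A b \<beta>
  proof -
    define x where "x = \<beta> - ln e + h 1"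
    have bnd: "ln e \<le> \<beta>" "norm (A *v x0 - b) \<le> x / h 1" "norm (column j A) \<le> 4 / r * (x / h 1)" for j
      using cover_parameter_bounds[OF r e ball cov] by (simp_all add: x_def)
    have "V * \<bar>det A\<bar> \<le> \<bar>V\<bar> * \<bar>det A\<bar>" by (intro mult_right_mono) auto
    with V have "exp \<beta> \<le> \<bar>V\<bar> * \<bar>det A\<bar>" by (rule order_trans)
    also have "\<dots> \<le> \<bar>V\<bar> * (fact ?n * (4 / r * (x / h 1)) ^ ?n)"
      using matrix_norm_bounds_of_columns(1)[OF bnd(3)] by (intro mult_left_mono) auto
    also have "\<dots> = \<bar>V\<bar> * fact ?n * (4 / r / h 1) ^ ?n * x ^ ?n"
      by (simp add: power_divide power_mult_distrib)
    finally have "exp (h 1) / e * exp \<beta> \<le> exp (h 1) / e * (\<bar>V\<bar> * fact ?n * (4 / r / h 1) ^ ?n * x ^ ?n)"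
      using e by (intro mult_left_mono) auto
    moreover have "exp x = exp (h 1) / e * exp \<beta>" using e by (simp add: x_def exp_add exp_diff)
    ultimately have "exp x \<le> W * x ^ ?n" by (simp only: W_def mult.assoc)
    hence xX: "x \<le> X" by (rule X)
    hence R: "x / h 1 \<le> X / h 1" using h1 by (simp add: divide_right_mono)
    hence S: "4 / r * (x / h 1) \<le> S" unfolding S_def using r by (intro mult_left_mono) auto
    have col: "norm (column j A) \<le> S" for j using bnd(3)[of j] S by (rule order_trans)
    have "norm b \<le> norm (A *v x0) + norm (A *v x0 - b)" by (metis norm_triangle_sub norm_minus_commute)
    hence "norm b \<le> (\<Sum>j\<in>UNIV. \<bar>x0 $ j\<bar>) * S + X / h 1"
      using matrix_norm_bounds_of_columns(3)[OF col, of x0] bnd(2) R by linarith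
    moreover have "\<bar>\<beta>\<bar> \<le> \<bar>X\<bar> + \<bar>ln e\<bar> + h 1" using xX bnd(1) h1 unfolding x_def by linarith
    moreover have "norm A \<le> (real ?n)\<^sup>2 * S" by (rule matrix_norm_bounds_of_columns(2)[OF col])
    moreover have "norm (A, b, \<beta>) \<le> norm A + (norm b + norm \<beta>)"
      using norm_Pair_le[of A "(b, \<beta>)"] norm_Pair_le[of b \<beta>] by linarith
    ultimately show ?thesis by (simp add: B_def)
  qed
  thus ?thesis by (intro boundedI[of _ B]) auto
qed

text \<open>Multiplying out the cost bound replaces invertibility, which is not a closed condition:
  the product form is closed, and as \<open>exp \<beta>\<close> is positive it still forces a
  nonzero determinant.\<close>

lemma closed_covers:
  fixes f :: "real^'n \<Rightarrow> real"
  shows "closed {(A, b, \<beta>). covers f A b \<beta> \<and> exp \<beta> \<le> V * \<bar>det A\<bar>}"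
proof -
  have c: "continuous_on UNIV (\<lambda>p::(real^'n^'n) \<times> (real^'n) \<times> real. exp (snd (snd p) - h (norm (fst p *v x - fst (snd p)))))" for x
    by (intro continuous_intros continuous_on_compose2[OF continuous])
       (auto simp: matrix_vector_mult_def intro!: continuous_intros)
  have d: "continuous_on UNIV (\<lambda>p::(real^'n^'n) \<times> (real^'n) \<times> real. V * \<bar>det (fst p)\<bar>)"
    unfolding det_def by (intro continuous_intros)
  have "{(A, b, \<beta>). covers f A b \<beta> \<and> exp \<beta> \<le> V * \<bar>det A\<bar>} =
      (\<Inter>x. {p. f x \<le> exp (snd (snd p) - h (norm (fst p *v x - fst (snd p))))}) \<inter>
      {p. exp (snd (snd p)) \<le> V * \<bar>det (fst p)\<bar>}"
    by (auto simp: covers_def)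
  moreover have "closed \<dots>"
    by (intro closed_Int closed_INT ballI closed_Collect_le c d) (auto intro!: continuous_intros)
  ultimately show ?thesis by simp
qed

text \<open>A multiple of the identity matrix serves: by \<open>le_id\<close> the profile decays no
  faster than the exponential of the norm.\<close>

lemma covers_exists_of_exponential_decay:
  fixes f :: "real^'n \<Rightarrow> real"
  assumes c: "c > 0" and C: "C > 0" and le: "\<And>x. f x \<le> C * exp (- c * norm (x - x0))"
  shows "\<exists>A b \<beta>. invertible A \<and> covers f A b \<beta>"
proof (intro exI conjI)
  let ?A = "mat c :: real^'n^'n"
  have A: "?A *v y = c *\<^sub>R y" for y
    by (simp add: vec_eq_iff matrix_vector_mult_def mat_def if_distrib[of "\<lambda>z. z * _"] cong: if_cong)
  have "det ?A = c ^ CARD('n)" by (simp add: matrix_scaleR[symmetric])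
  thus "invertible ?A" using c by (simp add: invertible_det_nz)
  show "covers f ?A (c *\<^sub>R x0) (ln C)"
    unfolding covers_def
  proof
    fix x
    have n: "norm (?A *v x - c *\<^sub>R x0) = c * norm (x - x0)"
      using c by (simp add: A scaleR_diff_right[symmetric])
    have "f x \<le> exp (ln C - c * norm (x - x0))"
      using le[of x] C by (simp add: exp_diff exp_minus field_simps)
    also have "\<dots> \<le> exp (ln C - h (norm (?A *v x - c *\<^sub>R x0)))"
      using le_id[of "c * norm (x - x0)"] c by (simp add: n)
    finally show "f x \<le> exp (ln C - h (norm (?A *v x - c *\<^sub>R x0)))" .
  qed
qed

lemma minimal_cover_exists:
  fixes f :: "real^'n \<Rightarrow> real"
  assumes f: "log_concave_fun f" and m: "f \<in> borel_measurable borel"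
    and pos: "0 < (\<integral>\<^sup>+x. ennreal (f x) \<partial>lborel)" and fin: "(\<integral>\<^sup>+x. ennreal (f x) \<partial>lborel) < \<infinity>"
  obtains A b \<beta> where "invertible A" "covers f A b \<beta>"
    "\<And>A' b' \<beta>'. invertible A' \<Longrightarrow> covers f A' b' \<beta>' \<Longrightarrow> cost A \<beta> \<le> cost A' \<beta>'"
proof -
  obtain x0 r e where r: "r > 0" and e: "e > 0" and ball: "\<And>y. y \<in> ball x0 r \<Longrightarrow> e \<le> f y"
    by (rule log_concave_ball_superlevel[OF f m pos]) (rule that)
  obtain c C where "c > 0" "C > 0" "\<And>x. f x \<le> C * exp (- c * norm (x - x0))"
    by (rule log_concave_exponential_decay[OF f m fin r e, of x0]) (erule ball, rule that)
  from covers_exists_of_exponential_decay[OF this]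
  obtain A0 b0 \<beta>0 where A0: "invertible A0" "covers f A0 b0 \<beta>0" by blast
  \<comment> \<open>The cost of one known cover as threshold makes the set nonempty, and an
    invertible cover outside the set is more expensive than this one.\<close>
  let ?V = "cost A0 \<beta>0"
  let ?S = "{(A, b, \<beta>). covers f A b \<beta> \<and> exp \<beta> \<le> ?V * \<bar>det A\<bar>}"
  have le_V: "exp \<beta> \<le> ?V * \<bar>det A\<bar> \<longleftrightarrow> cost A \<beta> \<le> ?V" if "invertible A" for A :: "real^'n^'n" and \<beta>
    using that by (simp add: cost_def[of A] invertible_det_nz pos_divide_le_eq)
  have det: "det A \<noteq> 0" if "(A, b, \<beta>) \<in> ?S" for A b \<beta>
    using that by (auto simp: not_le[symmetric])
  have "compact ?S"
    unfolding compact_eq_bounded_closed by (intro conjI bounded_covers[OF r e, of x0] closed_covers ball)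
  moreover have "(A0, b0, \<beta>0) \<in> ?S" using A0 le_V by simp
  hence "?S \<noteq> {}" by blast
  moreover have "continuous_on ?S (\<lambda>p. exp (snd (snd p)) / \<bar>det (fst p)\<bar>)"
  proof (intro continuous_intros)
    show "continuous_on ?S (\<lambda>p. det (fst p))" unfolding det_def by (intro continuous_intros)
    show "\<forall>p\<in>?S. \<bar>det (fst p)\<bar> \<noteq> 0" using det by fastforce
  qed
  ultimately obtain p where p: "p \<in> ?S"
    and min: "\<And>q. q \<in> ?S \<Longrightarrow> exp (snd (snd p)) / \<bar>det (fst p)\<bar> \<le> exp (snd (snd q)) / \<bar>det (fst q)\<bar>"
    using continuous_attains_inf[of ?S] by blast
  obtain A b \<beta> where [simp]: "p = (A, b, \<beta>)" by (cases p)
  have A: "invertible A" "covers f A b \<beta>" using p det[of A b \<beta>] by (auto simp: invertible_det_nz)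
  show ?thesis
  proof (rule that[OF A])
    fix A' b' \<beta>' assume *: "invertible A'" "covers f A' b' \<beta>'"
    show "cost A \<beta> \<le> cost A' \<beta>'"
    proof (cases "(A', b', \<beta>') \<in> ?S")
      case True
      from min[OF this] show ?thesis by (simp add: cost_def)
    next
      case False
      hence "?V < cost A' \<beta>'" using * le_V by auto
      moreover have "cost A \<beta> \<le> ?V" using p le_V[OF A(1)] by simp
      ultimately show ?thesis by simp
    qed
  qed
qed

section \<open>From parameter triples back to the ellipsoidal class\<close>

lemma ellipsoidal_class_eq:
  "(l :: real^'n \<Rightarrow> real) \<in> ellipsoidal_class h \<longleftrightarrow>
     (\<exists>(A::real^'n^'n) b \<beta>. invertible A \<and> l = (\<lambda>x. exp (\<beta> - h (norm (A *v x - b)))))"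
proof
  assume "l \<in> ellipsoidal_class h"
  then obtain A :: "real^'n^'n" and \<alpha> a where "l = (\<lambda>x. \<alpha> * exp (- h (norm (A *v (x - a)))))" "invertible A" "\<alpha> > 0"
    unfolding ellipsoidal_class_def by blast
  hence "l = (\<lambda>x. exp (ln \<alpha> - h (norm (A *v x - A *v a))))"
    by (simp add: matrix_vector_mult_diff_distrib exp_diff exp_minus divide_inverse)
  thus "\<exists>(A::real^'n^'n) b \<beta>. invertible A \<and> l = (\<lambda>x. exp (\<beta> - h (norm (A *v x - b))))"
    using \<open>invertible A\<close> by blast
next
  assume "\<exists>(A::real^'n^'n) b \<beta>. invertible A \<and> l = (\<lambda>x. exp (\<beta> - h (norm (A *v x - b))))"
  then obtain A :: "real^'n^'n" and b \<beta> where A: "invertible A" and l: "l = (\<lambda>x. exp (\<beta> - h (norm (A *v x - b))))"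
    by blast
  obtain N where "A ** N = mat 1" using A by (auto simp: invertible_def)
  hence b: "A *v (N *v b) = b" by (simp add: matrix_vector_mul_assoc)
  have "l = (\<lambda>x. exp \<beta> * exp (- h (norm (A *v (x - N *v b)))))"
    by (simp add: l matrix_vector_mult_diff_distrib b exp_diff exp_minus divide_inverse)
  thus "l \<in> ellipsoidal_class h" using A unfolding ellipsoidal_class_def by fastforce
qed

theorem ellipsoidal_minimizer_ex1:
  fixes f :: "real^'n \<Rightarrow> real"
  assumes f: "log_concave_fun f" and m: "f \<in> borel_measurable borel"
    and pos: "0 < (\<integral>\<^sup>+x. ennreal (f x) \<partial>lborel)" and fin: "(\<integral>\<^sup>+x. ennreal (f x) \<partial>lborel) < \<infinity>"
  shows "\<exists>!l. is_arg_min (\<lambda>l. \<integral>\<^sup>+x. ennreal (l x) \<partial>lborel) (\<lambda>l. l \<in> ellipsoidal_class h \<and> f \<le> l) l"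
proof -
  let ?I = "\<lambda>l :: real^'n \<Rightarrow> real. \<integral>\<^sup>+x. ennreal (l x) \<partial>lborel"
  let ?l = "\<lambda>(A::real^'n^'n) b \<beta> x. exp (\<beta> - h (norm (A *v x - b)))"
  have feas: "l \<in> ellipsoidal_class h \<and> f \<le> l \<longleftrightarrow> (\<exists>A b \<beta>. invertible A \<and> covers f A b \<beta> \<and> l = ?l A b \<beta>)" for l
    unfolding ellipsoidal_class_eq covers_def by (auto simp: le_fun_def)
  \<comment> \<open>\<open>is_arg_min\<close> compares extended integrals strictly; each is a cost
    times the positive finite mass, which cancels.\<close>
  have less: "?I (?l A b \<beta>) < ?I (?l A' b' \<beta>') \<longleftrightarrow> cost A \<beta> < cost A' \<beta>'"
    if "invertible A" "invertible A'" for A A' b b' \<beta> \<beta>'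
  proof -
    have "?I (?l A b \<beta>) < ?I (?l A' b' \<beta>') \<longleftrightarrow> \<not> (mass TYPE('n) * ennreal (cost A' \<beta>') \<le> mass TYPE('n) * ennreal (cost A \<beta>))"
      by (simp add: nn_integral_profile that cost_def mult.commute not_le)
    also have "\<dots> \<longleftrightarrow> \<not> ennreal (cost A' \<beta>') \<le> ennreal (cost A \<beta>)"
      using mass_pos[where 'n='n] mass_finite[where 'n='n] by (subst ennreal_mult_le_mult_iff) auto
    also have "\<dots> \<longleftrightarrow> cost A \<beta> < cost A' \<beta>'"
      by (simp add: cost_def not_le ennreal_less_iff)
    finally show ?thesis .
  qed
  obtain A b \<beta> where A: "invertible A" "covers f A b \<beta>"
    and min: "\<And>A' b' \<beta>'. invertible A' \<Longrightarrow> covers f A' b' \<beta>' \<Longrightarrow> cost A \<beta> \<le> cost A' \<beta>'"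
    by (rule minimal_cover_exists[OF f m pos fin]) (rule that)
  show ?thesis
  proof (rule ex1I)
    show "is_arg_min ?I (\<lambda>l. l \<in> ellipsoidal_class h \<and> f \<le> l) (?l A b \<beta>)"
      unfolding is_arg_min_def
    proof (rule conjI[OF _ notI])
      show "?l A b \<beta> \<in> ellipsoidal_class h \<and> f \<le> ?l A b \<beta>" unfolding feas using A by blast
      assume "\<exists>y. (y \<in> ellipsoidal_class h \<and> f \<le> y) \<and> ?I y < ?I (?l A b \<beta>)"
      then obtain A' b' \<beta>' where A': "invertible A'" "covers f A' b' \<beta>'" and "?I (?l A' b' \<beta>') < ?I (?l A b \<beta>)"
        unfolding feas by blast
      hence "cost A' \<beta>' < cost A \<beta>" using less[OF A'(1) A(1)] by blast
      thus False using min[OF A'] by simp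
    qed
    fix l assume l: "is_arg_min ?I (\<lambda>l. l \<in> ellipsoidal_class h \<and> f \<le> l) l"
    then obtain A' b' \<beta>' where A': "invertible A'" "covers f A' b' \<beta>'" and leq: "l = ?l A' b' \<beta>'"
      unfolding is_arg_min_def feas by blast
    have "\<not> ?I (?l A b \<beta>) < ?I (?l A' b' \<beta>')"
      using l A unfolding is_arg_min_def feas leq by blast
    hence "\<not> cost A \<beta> < cost A' \<beta>'" using less[OF A(1) A'(1)] by blast
    hence "cost A' \<beta>' = cost A \<beta>" using min[OF A'] by simp
    from minimal_cover_unique[OF A A' min this] show "l = ?l A b \<beta>" unfolding leq by (intro ext) simp
  qed
qed

end

theorem theorem1p2:
  fixes s :: real and f :: "real ^ 'n::finite \<Rightarrow> real"
  assumes "s \<ge> 0"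
    and "\<And>x. f x \<ge> 0"
    and "upper_semicontinuous f"
    and "log_concave_fun f"
    and "0 < (\<integral>\<^sup>+ x. ennreal (f x) \<partial>lborel)"
    and "(\<integral>\<^sup>+ x. ennreal (f x) \<partial>lborel) < \<infinity>"
  shows "\<exists>!l. is_arg_min (\<lambda>l. \<integral>\<^sup>+ x. ennreal (l x) \<partial>lborel)
                (\<lambda>l. l \<in> ellipsoidal_class (psi s) \<and> f \<le> l) l"
proof -
  interpret convex_profile "psi s" using assms(1) by (rule convex_profile_psi)
  show ?thesis
    using assms(4) upper_semicontinuous_borel_measurable[OF assms(3)] assms(5,6)
    by (rule ellipsoidal_minimizer_ex1)
qed

end
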